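(* Let $K$ be a field, $S=K[x_1,\ldots,x_n]$, $\mathfrak m=(x_1,\ldots,x_n)$, and let $I\subset S$ be the squarefree strongly stable principal ideal with Borel generator $u=x_{i_1}x_{i_2}\cdots x_{i_{d-1}}x_n$, where $1<i_1<i_2<\cdots<i_{d-1}<n$ (and $n>1$). Write the set $\{i_1,\ldots,i_{d-1},n\}$ as the disjoint union of its maximal intervals of consecutive integers, $$\{i_1,\ldots,i_{d-1},n\}=\bigcup_{j=1}^m[a_j,b_j],\qquad a_j\le b_j,\quad b_j+1<a_{j+1}\ \text{ for } j=1,\ldots,m-1 ,$$ so that $b_m=n$. Define $$l_j=\begin{cases} b_j-a_j+1, & j<m,\\ n-a_m, & j=m,\end{cases}\qquad k_j=\begin{cases} a_1-1, & j=1,\\ a_j-b_{j-1}-1, & j>1.\end{cases}$$ Then $$\lambda(\mathfrak m;I)=\max_{j=1,\ldots,m}\left\{\left\lceil \frac{l_1+l_2+\cdots+l_j}{k_1+k_2+\cdots+k_j}\right\rceil+1\right\}.$$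
   Context: For an ideal $J\subset S$, $\operatorname{Ass}(J)$ denotes the set of associated prime ideals of $S/J$. For a monomial ideal $I$ and a monomial prime ideal $P$, $\lambda(P;I)$ (the index of stability of $P$ with respect to $I$) is the smallest integer $k\ge 1$ with $P\in\operatorname{Ass}(I^k)$, and $\lambda(P;I)=\infty$ if there is no such $k$. For a monomial ideal $I$, $G(I)$ denotes its unique minimal set of monomial generators. A monomial ideal $I\subset S$ generated in a single degree is squarefree strongly stable if all $u\in G(I)$ are squarefree and, for every $u\in G(I)$ and all $1\le i<j\le n$ such that $x_j\mid u$ and $x_i\nmid u$, one has $x_i(u/x_j)\in G(I)$. It is a squarefree strongly stable principal ideal with Borel generator $u\in G(I)$ if it is the smallest squarefree strongly stable ideal containing $u$. Explicitly, if $u=x_{i_1}\cdots x_{i_d}$ with $1\le i_1<\cdots<i_d\le n$, then $G(I)=\{x_{j_1}\cdots x_{j_d} : 1\le j_1<\cdots<j_d\le n,\ j_k\le i_k \text{ for } 1\le k\le d\}$. Here $[a,b]$ denotes the set of integers $t$ with $a\le t\le b$. *)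

theory Defs
  imports Complex_Main "HOL-Library.Poly_Mapping" "HOL-Library.Extended_Nat" "HOL-Algebra.QuotRing" "HOL-Algebra.Ideal_Product"
begin

text \<open>
  Monomials are identified with their exponent vectors, of type \<open>nat \<Rightarrow>\<^sub>0 nat\<close>; a polynomial is a
  finitely supported coefficient function on monomials, with the convolution product of
  \<open>HOL-Library.Poly_Mapping\<close>.  Note that the order \<open>\<le>\<close> on exponent vectors provided by that theory
  is lexicographic and is not divisibility; it is not used here.
\<close>

type_synonym monomial = "nat \<Rightarrow>\<^sub>0 nat"
type_synonym 'k mpoly = "monomial \<Rightarrow>\<^sub>0 'k"

definition monomials :: "nat \<Rightarrow> monomial set" where
  "monomials n = {t. Poly_Mapping.keys t \<subseteq> {1..n}}"

definition mon :: "monomial \<Rightarrow> 'k::field mpoly" where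
  "mon t = Poly_Mapping.single t 1"

definition poly_ring :: "nat \<Rightarrow> 'k::field mpoly ring" where
  "poly_ring n = \<lparr>carrier = {p. Poly_Mapping.keys p \<subseteq> monomials n},
     monoid.mult = (*), one = 1, zero = 0, add = (+)\<rparr>"

lemma monomials_add: "s \<in> monomials n \<Longrightarrow> t \<in> monomials n \<Longrightarrow> s + t \<in> monomials n"
  unfolding monomials_def using Poly_Mapping.keys_add[of s t] by blast

lemma cring_poly_ring: "cring (poly_ring n :: 'k::field mpoly ring)"
proof (rule cringI)
  show "abelian_group (poly_ring n :: 'k mpoly ring)"
  proof (rule abelian_groupI)
    fix x y :: "'k mpoly"
    assume "x \<in> carrier (poly_ring n)" "y \<in> carrier (poly_ring n)"
    then show "x \<oplus>\<^bsub>poly_ring n\<^esub> y \<in> carrier (poly_ring n)"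
      using Poly_Mapping.keys_add[of x y] by (auto simp: poly_ring_def)
  next
    fix x :: "'k mpoly"
    assume "x \<in> carrier (poly_ring n)"
    then show "\<exists>y\<in>carrier (poly_ring n). y \<oplus>\<^bsub>poly_ring n\<^esub> x = \<zero>\<^bsub>poly_ring n\<^esub>"
      by (intro bexI[of _ "- x"]) (auto simp: poly_ring_def)
  qed (auto simp: poly_ring_def add.assoc add.commute)
  show "Group.comm_monoid (poly_ring n :: 'k mpoly ring)"
  proof (rule comm_monoidI)
    fix x y :: "'k mpoly"
    assume "x \<in> carrier (poly_ring n)" "y \<in> carrier (poly_ring n)"
    then show "x \<otimes>\<^bsub>poly_ring n\<^esub> y \<in> carrier (poly_ring n)"
      using Poly_Mapping.keys_mult[of x y] monomials_add by (fastforce simp: poly_ring_def)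
  next
    show "\<one>\<^bsub>poly_ring n\<^esub> \<in> carrier (poly_ring n :: 'k mpoly ring)"
      by (auto simp: poly_ring_def monomials_def)
  qed (auto simp: poly_ring_def mult.assoc mult.commute)
qed (auto simp: poly_ring_def distrib_right)

text \<open>
  \<open>Ass(J)\<close>, the associated primes of the \<open>R\<close>-module \<open>R/J\<close>: the prime ideals of \<open>R\<close> that are
  annihilators of an element \<open>f\<close> of \<open>R/J\<close>, where \<open>r \<in> R\<close> acts on \<open>R/J\<close> through its class \<open>r + J\<close>.
\<close>

definition Ass :: "('a, 'b) ring_scheme \<Rightarrow> 'a set \<Rightarrow> 'a set set" where
  "Ass R J = {P. primeideal P R \<and>
     (\<exists>f\<in>carrier (R Quot J).
        P = {r \<in> carrier R. (J +>\<^bsub>R\<^esub> r) \<otimes>\<^bsub>R Quot J\<^esub> f = \<zero>\<^bsub>R Quot J\<^esub>})}"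

definition index_of_stability :: "('a, 'b) ring_scheme \<Rightarrow> 'a set \<Rightarrow> 'a set \<Rightarrow> enat" where
  "index_of_stability R P I =
     (if \<exists>k::nat. k \<ge> 1 \<and> P \<in> Ass R (I [^]\<^bsub>ideals_set R\<^esub> k)
      then enat (LEAST k::nat. k \<ge> 1 \<and> P \<in> Ass R (I [^]\<^bsub>ideals_set R\<^esub> k))
      else \<infinity>)"

definition max_ideal :: "nat \<Rightarrow> 'k::field mpoly set" where
  "max_ideal n = Idl\<^bsub>poly_ring n\<^esub> ((\<lambda>i. mon (Poly_Mapping.single i 1)) ` {1..n})"

definition monomial_ideal :: "nat \<Rightarrow> 'k::field mpoly set \<Rightarrow> bool" where
  "monomial_ideal n I \<longleftrightarrow> (\<exists>A \<subseteq> monomials n. I = Idl\<^bsub>poly_ring n\<^esub> (mon ` A))"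

definition minimal_monomial_generators :: "nat \<Rightarrow> 'k::field mpoly set \<Rightarrow> monomial set \<Rightarrow> bool" where
  "minimal_monomial_generators n I A \<longleftrightarrow>
     A \<subseteq> monomials n \<and> Idl\<^bsub>poly_ring n\<^esub> (mon ` A) = I \<and>
     (\<forall>B. B \<subset> A \<longrightarrow> Idl\<^bsub>poly_ring n\<^esub> (mon ` B) \<noteq> I)"

text \<open>\<open>G(I)\<close>; meaningful only for monomial ideals, where the minimal generating set is unique.\<close>

definition min_gens :: "nat \<Rightarrow> 'k::field mpoly set \<Rightarrow> monomial set" where
  "min_gens n I = (THE A. minimal_monomial_generators n I A)"

definition mono_degree :: "monomial \<Rightarrow> nat" where
  "mono_degree t = (\<Sum>i\<in>Poly_Mapping.keys t. Poly_Mapping.lookup t i)"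

definition squarefree_mono :: "monomial \<Rightarrow> bool" where
  "squarefree_mono t \<longleftrightarrow> (\<forall>i. Poly_Mapping.lookup t i \<le> 1)"

text \<open>
  On exponent vectors, \<open>x\<^sub>j\<close> divides \<open>u\<close> iff \<open>j \<in> keys u\<close>, and \<open>x\<^sub>i (u / x\<^sub>j)\<close> is
  \<open>single i 1 + (u - single j 1)\<close>.
\<close>

definition squarefree_strongly_stable :: "nat \<Rightarrow> 'k::field mpoly set \<Rightarrow> bool" where
  "squarefree_strongly_stable n I \<longleftrightarrow>
     monomial_ideal n I \<and>
     (\<exists>d. \<forall>u\<in>min_gens n I. mono_degree u = d) \<and>
     (\<forall>u\<in>min_gens n I. squarefree_mono u) \<and>
     (\<forall>u\<in>min_gens n I. \<forall>i j. 1 \<le> i \<and> i < j \<and> j \<le> n \<and>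
        j \<in> Poly_Mapping.keys u \<and> i \<notin> Poly_Mapping.keys u \<longrightarrow>
        Poly_Mapping.single i 1 + (u - Poly_Mapping.single j 1) \<in> min_gens n I)"

definition squarefree_strongly_stable_principal ::
    "nat \<Rightarrow> monomial \<Rightarrow> 'k::field mpoly set \<Rightarrow> bool" where
  "squarefree_strongly_stable_principal n u I \<longleftrightarrow>
     squarefree_strongly_stable n I \<and> u \<in> min_gens n I \<and>
     (\<forall>J. squarefree_strongly_stable n J \<and> mon u \<in> J \<longrightarrow> I \<subseteq> J)"

end

theory Submission
  imports Defs
begin

text \<open>
  A monomial \<open>x\<^sup>e\<close> lies in \<open>I\<^sup>k\<close> iff \<open>\<Sum>\<^bsub>s \<le> i\<^sub>t\<^esub> min e\<^sub>s k \<ge> k t\<close> for all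
  \<open>1 \<le> t \<le> d\<close>: if the inequalities hold for \<open>k + 1\<close>, a generator of \<open>I\<close> can be split off from
  \<open>x\<^sup>e\<close> by rounding down the prefix sums of \<open>min e\<^sub>s (k + 1)\<close> divided by \<open>k + 1\<close>.
  The maximal ideal is associated to \<open>I\<^sup>k\<close> iff there is a monomial outside \<open>I\<^sup>k\<close> all of whose
  multiples by a variable are in \<open>I\<^sup>k\<close>.  Since \<open>i\<^sub>t < n\<close> for \<open>t < d\<close>, multiplying by \<open>x\<^sub>n\<close> only
  affects the inequality for \<open>t = d\<close>; hence such a monomial has all exponents at most \<open>k - 1\<close>, total
  degree \<open>k d - 1\<close>, and satisfies the inequalities for \<open>t < d\<close>.  One exists iff
  \<open>t \<le> (k - 1) (i\<^sub>t - t)\<close> for all \<open>t < d\<close>.  As \<open>i\<^sub>t - t\<close> is constant on an interval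
  \<open>[a\<^sub>j, b\<^sub>j]\<close>, only the right ends of the intervals matter, which gives the formula.
\<close>

section \<open>Ideals spanned by monomials\<close>

text \<open>For an \<open>absorbing\<close> set \<open>F\<close> this is the monomial ideal whose
  monomials are exactly those in \<open>F\<close>, so questions about ideals become questions about
  sets of exponent vectors.\<close>

definition mono_span :: "monomial set \<Rightarrow> 'k::field mpoly set" where
  "mono_span F = {p. Poly_Mapping.keys p \<subseteq> F}"

text \<open>The exponent sets of monomial ideals. Divisibility is expressed through sums, the order
  on exponent vectors being lexicographic.\<close>

definition absorbing :: "nat \<Rightarrow> monomial set \<Rightarrow> bool" where
  "absorbing n F \<longleftrightarrow> F \<subseteq> monomials n \<and> (\<forall>t\<in>F. \<forall>s\<in>monomials n. t + s \<in> F)"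

definition multiples :: "nat \<Rightarrow> monomial set \<Rightarrow> monomial set" where
  "multiples n A = {a + s |a s. a \<in> A \<and> s \<in> monomials n}"

lemma zero_in_monomials: "0 \<in> monomials n"
  by (simp add: monomials_def)

lemma monomials_addD:
  assumes "s + t \<in> monomials n"
  shows "s \<in> monomials n" "t \<in> monomials n"
proof -
  have "Poly_Mapping.keys s \<union> Poly_Mapping.keys t \<subseteq> Poly_Mapping.keys (s + t)"
    by (auto simp: in_keys_iff lookup_add)
  then show "s \<in> monomials n" "t \<in> monomials n"
    using assms by (auto simp: monomials_def)
qed

lemma absorbing_multiples: "A \<subseteq> monomials n \<Longrightarrow> absorbing n (multiples n A)"
  unfolding absorbing_def multiples_def
  by (auto intro: monomials_add) (metis add.assoc monomials_add)

lemma subset_multiples: "A \<subseteq> multiples n A"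
  unfolding multiples_def using zero_in_monomials by force

lemma poly_mapping_sum_single:
  "p = (\<Sum>t\<in>Poly_Mapping.keys p. Poly_Mapping.single t (Poly_Mapping.lookup p t))"
proof (rule poly_mapping_eqI)
  fix t
  have "Poly_Mapping.lookup (\<Sum>t\<in>Poly_Mapping.keys p. Poly_Mapping.single t (Poly_Mapping.lookup p t)) t
      = (\<Sum>s\<in>Poly_Mapping.keys p. if s = t then Poly_Mapping.lookup p s else 0)"
    by (auto simp: lookup_sum lookup_single when_def intro!: sum.cong)
  also have "\<dots> = Poly_Mapping.lookup p t"
    by (simp add: in_keys_iff)
  finally show "Poly_Mapping.lookup p t = Poly_Mapping.lookup (\<Sum>t\<in>Poly_Mapping.keys p. Poly_Mapping.single t (Poly_Mapping.lookup p t)) t"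
    by simp
qed

text \<open>Translation by \<open>e\<close> is injective, so no terms cancel and the supports agree;
  \<open>keys_mult\<close> alone gives only one inclusion.\<close>

lemma keys_mon_mult:
  fixes p :: "'k::field mpoly"
  shows "Poly_Mapping.keys (mon e * p) = (+) e ` Poly_Mapping.keys p"
proof -
  have "mon e * p = (\<Sum>t\<in>Poly_Mapping.keys p. Poly_Mapping.single (e + t) (Poly_Mapping.lookup p t))"
    by (subst poly_mapping_sum_single[of p]) (simp add: mon_def sum_distrib_left mult_single)
  then have lookup: "Poly_Mapping.lookup (mon e * p) u
      = (\<Sum>t\<in>Poly_Mapping.keys p. Poly_Mapping.lookup p t when e + t = u)" for u
    by (simp add: lookup_sum lookup_single)
  have "Poly_Mapping.lookup (mon e * p) (e + t) = Poly_Mapping.lookup p t" for t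
  proof -
    have "Poly_Mapping.lookup (mon e * p) (e + t)
        = (\<Sum>s\<in>Poly_Mapping.keys p. if s = t then Poly_Mapping.lookup p s else 0)"
      unfolding lookup by (auto simp: when_def intro!: sum.cong)
    then show ?thesis by (simp add: in_keys_iff)
  qed
  then have "(+) e ` Poly_Mapping.keys p \<subseteq> Poly_Mapping.keys (mon e * p)"
    by (auto simp: in_keys_iff)
  moreover have "Poly_Mapping.keys (mon e * p) \<subseteq> (+) e ` Poly_Mapping.keys p"
    using keys_mult[of "mon e" p] by (auto simp: mon_def)
  ultimately show ?thesis by blast
qed

lemma keys_mon [simp]: "Poly_Mapping.keys (mon e :: 'k::field mpoly) = {e}"
  by (simp add: mon_def)

lemma mon_in_span [simp]: "mon e \<in> mono_span F \<longleftrightarrow> e \<in> F"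
  by (simp add: mono_span_def)

lemma mono_span_inject: "mono_span F = (mono_span G :: 'k::field mpoly set) \<longleftrightarrow> F = G"
  by (metis mon_in_span subsetI subset_antisym)

lemma carrier_poly_ring: "carrier (poly_ring n) = mono_span (monomials n)"
  by (simp add: poly_ring_def mono_span_def)

lemma poly_ring_simps [simp]:
  "x \<otimes>\<^bsub>poly_ring n\<^esub> y = x * y" "x \<oplus>\<^bsub>poly_ring n\<^esub> y = x + y"
  "\<zero>\<^bsub>poly_ring n\<^esub> = 0" "\<one>\<^bsub>poly_ring n\<^esub> = 1"
  by (auto simp: poly_ring_def)

lemma zero_in_span: "0 \<in> mono_span F"
  by (simp add: mono_span_def)

lemma add_in_span: "p \<in> mono_span F \<Longrightarrow> q \<in> mono_span F \<Longrightarrow> p + q \<in> mono_span F"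
  using keys_add[of p q] by (auto simp: mono_span_def)

lemma mult_in_span:
  "p \<in> mono_span F \<Longrightarrow> q \<in> mono_span G \<Longrightarrow> (\<And>s t. s \<in> F \<Longrightarrow> t \<in> G \<Longrightarrow> s + t \<in> H)
    \<Longrightarrow> p * q \<in> mono_span H"
  using keys_mult[of p q] unfolding mono_span_def by fastforce

lemma ideal_mono_span:
  assumes "absorbing n F"
  shows "ideal (mono_span F) (poly_ring n :: 'k::field mpoly ring)"
proof -
  interpret R: cring "poly_ring n :: 'k mpoly ring" by (rule cring_poly_ring)
  have sub: "mono_span F \<subseteq> carrier (poly_ring n :: 'k mpoly ring)"
    using assms by (auto simp: carrier_poly_ring mono_span_def absorbing_def)
  have neg: "\<ominus>\<^bsub>poly_ring n\<^esub> p \<in> mono_span F" if "p \<in> mono_span F" for p :: "'k mpoly"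
  proof -
    have "- p \<in> carrier (poly_ring n)"
      using sub that by (auto simp: carrier_poly_ring mono_span_def)
    then have "\<ominus>\<^bsub>poly_ring n\<^esub> p = - p"
      using sub that by (intro R.minus_equality) auto
    then show ?thesis using that by (simp add: mono_span_def)
  qed
  show ?thesis
  proof (rule idealI)
    show "subgroup (mono_span F) (add_monoid (poly_ring n :: 'k mpoly ring))"
      by (rule subgroup.intro)
        (use sub neg[unfolded a_inv_def] in \<open>auto simp: zero_in_span add_in_span\<close>)
  next
    fix a x :: "'k mpoly"
    assume *: "a \<in> mono_span F" "x \<in> carrier (poly_ring n)"
    have "x * a \<in> mono_span F"
      by (rule mult_in_span[OF *(2)[unfolded carrier_poly_ring] *(1)])
        (metis absorbing_def add.commute assms)
    then show "x \<otimes>\<^bsub>poly_ring n\<^esub> a \<in> mono_span F" "a \<otimes>\<^bsub>poly_ring n\<^esub> x \<in> mono_span F"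
      by (simp_all add: mult.commute)
  qed (rule R.ring_axioms)
qed

lemma sum_in_ideal:
  fixes J :: "'k::field mpoly set"
  assumes "ideal J (poly_ring n)" "\<And>x. x \<in> X \<Longrightarrow> f x \<in> J"
  shows "sum f X \<in> J"
proof -
  interpret J: ideal J "poly_ring n" by fact
  show ?thesis
    using assms(2)
  proof (induction X rule: infinite_finite_induct)
    case (insert x X)
    then show ?case
      using additive_subgroup.a_closed[OF J.additive_subgroup_axioms, of "f x" "sum f X"] by simp
  qed (use additive_subgroup.zero_closed[OF J.additive_subgroup_axioms] in auto)
qed

text \<open>Each term of \<open>p\<close> is a constant times some \<open>mon t\<close> with
  \<open>t \<in> F\<close>, and \<open>p\<close> is the sum of its terms.\<close>

lemma span_subset_ideal:
  fixes J :: "'k::field mpoly set"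
  assumes "ideal J (poly_ring n)" "F \<subseteq> monomials n" "\<And>t. t \<in> F \<Longrightarrow> mon t \<in> J"
  shows "mono_span F \<subseteq> J"
proof
  fix p :: "'k mpoly" assume p: "p \<in> mono_span F"
  interpret J: ideal J "poly_ring n" by fact
  have "Poly_Mapping.single t (Poly_Mapping.lookup p t) \<in> J" if "t \<in> Poly_Mapping.keys p" for t
  proof -
    have "mon t \<in> J" using p that assms(3) by (auto simp: mono_span_def)
    moreover have "Poly_Mapping.single 0 (Poly_Mapping.lookup p t) \<in> carrier (poly_ring n)"
      by (auto simp: poly_ring_def zero_in_monomials)
    ultimately show ?thesis
      using J.I_l_closed[of "mon t" "Poly_Mapping.single 0 (Poly_Mapping.lookup p t)"]
      by (simp add: mon_def mult_single)
  qed
  then show "p \<in> J"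
    by (subst poly_mapping_sum_single) (rule sum_in_ideal[OF assms(1)])
qed

lemma Idl_mon:
  assumes "A \<subseteq> monomials n"
  shows "Idl\<^bsub>poly_ring n\<^esub> (mon ` A) = (mono_span (multiples n A) :: 'k::field mpoly set)"
proof
  interpret R: cring "poly_ring n :: 'k mpoly ring" by (rule cring_poly_ring)
  show "Idl\<^bsub>poly_ring n\<^esub> (mon ` A) \<subseteq> (mono_span (multiples n A) :: 'k mpoly set)"
    by (rule R.genideal_minimal[OF ideal_mono_span[OF absorbing_multiples[OF assms]]])
      (use subset_multiples[of A n] in auto)
  have carr: "mon ` A \<subseteq> carrier (poly_ring n :: 'k mpoly ring)"
    using assms by (auto simp: carrier_poly_ring)
  interpret J: ideal "Idl\<^bsub>poly_ring n\<^esub> (mon ` A :: 'k mpoly set)" "poly_ring n"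
    by (rule R.genideal_ideal[OF carr])
  show "(mono_span (multiples n A) :: 'k mpoly set) \<subseteq> Idl\<^bsub>poly_ring n\<^esub> (mon ` A)"
  proof (rule span_subset_ideal[OF J.is_ideal])
    show "multiples n A \<subseteq> monomials n"
      using absorbing_multiples[OF assms] by (simp add: absorbing_def)
    fix t assume "t \<in> multiples n A"
    then obtain a s where t: "t = a + s" "a \<in> A" "s \<in> monomials n"
      by (auto simp: multiples_def)
    have "mon a \<in> Idl\<^bsub>poly_ring n\<^esub> (mon ` A :: 'k mpoly set)"
      using R.genideal_self[OF carr] t(2) by auto
    then have "mon a \<otimes>\<^bsub>poly_ring n\<^esub> mon s \<in> Idl\<^bsub>poly_ring n\<^esub> (mon ` A :: 'k mpoly set)"
      by (rule J.I_r_closed) (simp add: t carrier_poly_ring)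
    then show "mon t \<in> Idl\<^bsub>poly_ring n\<^esub> (mon ` A :: 'k mpoly set)"
      by (simp add: t mon_def mult_single)
  qed
qed

text \<open>The support of a product lies in the sumset of the supports; conversely each monomial of
  the sumset is itself a product of one monomial from each ideal.\<close>

lemma ideal_prod_mono_span:
  assumes "absorbing n F" "absorbing n G"
  shows "ideal_prod (poly_ring n) (mono_span F) (mono_span G)
    = (mono_span {s + t |s t. s \<in> F \<and> t \<in> G} :: 'k::field mpoly set)" (is "?P = mono_span ?H")
proof
  interpret R: cring "poly_ring n :: 'k mpoly ring" by (rule cring_poly_ring)
  note ids = assms(1)[THEN ideal_mono_span] assms(2)[THEN ideal_mono_span]
  show "?P \<subseteq> mono_span ?H"
  proof
    fix p assume "p \<in> ?P"
    then show "p \<in> mono_span ?H"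
    proof induction
      case (prod i j)
      then show ?case by (auto intro: mult_in_span)
    qed (auto intro: add_in_span)
  qed
  show "mono_span ?H \<subseteq> ?P"
  proof (rule span_subset_ideal[OF R.ideal_prod_is_ideal[OF ids]])
    show "?H \<subseteq> monomials n"
      using assms by (auto simp: absorbing_def intro: monomials_add)
    fix u assume "u \<in> ?H"
    then obtain s t where "u = s + t" "s \<in> F" "t \<in> G" by blast
    then show "mon u \<in> ?P"
      using ideal_prod.prod[of "mon s" "mono_span F" "mon t" "mono_span G" "poly_ring n"]
      by simp (simp add: mon_def mult_single)
  qed
qed

section \<open>The maximal ideal as an associated prime of a monomial ideal\<close>

lemma in_multiples_nonzero_iff:
  "t \<in> multiples n ((\<lambda>i. Poly_Mapping.single i 1) ` {1..n}) \<longleftrightarrow> t \<in> monomials n \<and> t \<noteq> 0"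
proof
  assume "t \<in> multiples n ((\<lambda>i. Poly_Mapping.single i 1) ` {1..n})"
  then obtain i s where t: "t = Poly_Mapping.single i 1 + s" "i \<in> {1..n}" "s \<in> monomials n"
    by (auto simp: multiples_def)
  then have "Poly_Mapping.lookup t i \<noteq> 0" by (simp add: lookup_add)
  moreover have "Poly_Mapping.single i 1 \<in> monomials n" using t by (simp add: monomials_def)
  ultimately show "t \<in> monomials n \<and> t \<noteq> 0" using t by (auto intro: monomials_add)
next
  assume t: "t \<in> monomials n \<and> t \<noteq> 0"
  then obtain i where i: "i \<in> Poly_Mapping.keys t" by (metis all_not_in_conv keys_eq_empty)
  have eq: "t = Poly_Mapping.single i 1 + (t - Poly_Mapping.single i 1)"
    by (rule poly_mapping_eqI)
      (use i in \<open>auto simp: lookup_add lookup_minus lookup_single when_def in_keys_iff\<close>)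
  then have "t - Poly_Mapping.single i 1 \<in> monomials n" using t monomials_addD by metis
  moreover have "i \<in> {1..n}" using t i by (auto simp: monomials_def)
  ultimately show "t \<in> multiples n ((\<lambda>i. Poly_Mapping.single i 1) ` {1..n})"
    unfolding multiples_def using eq by blast
qed

lemma max_ideal_eq: "max_ideal n = (mono_span (monomials n - {0}) :: 'k::field mpoly set)"
proof -
  have "multiples n ((\<lambda>i. Poly_Mapping.single i 1) ` {1..n}) = monomials n - {0}"
    using in_multiples_nonzero_iff by blast
  moreover have "(\<lambda>i. Poly_Mapping.single i 1) ` {1..n} \<subseteq> monomials n"
    by (auto simp: monomials_def)
  moreover have "max_ideal n
      = Idl\<^bsub>poly_ring n\<^esub> (mon ` (\<lambda>i. Poly_Mapping.single i 1) ` {1..n} :: 'k mpoly set)"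
    by (simp add: max_ideal_def image_image)
  ultimately show ?thesis using Idl_mon by metis
qed

text \<open>Modulo this ideal a polynomial is its constant term, and a product of nonzero constants
  in a field is nonzero.\<close>

lemma primeideal_max_ideal: "primeideal (max_ideal n) (poly_ring n :: 'k::field mpoly ring)"
proof (rule primeidealI)
  have abs: "absorbing n (monomials n - {0})"
    unfolding absorbing_def
    by (auto intro: monomials_add dest: arg_cong[of "_ + _" 0 Poly_Mapping.lookup])
       (metis add_eq_0_iff_both_eq_0 lookup_add lookup_zero poly_mapping_eqI)
  then show id: "ideal (max_ideal n) (poly_ring n :: 'k mpoly ring)"
    unfolding max_ideal_eq by (rule ideal_mono_span)
  show "cring (poly_ring n :: 'k mpoly ring)" by (rule cring_poly_ring)
  have "(1 :: 'k mpoly) \<notin> max_ideal n" by (simp add: max_ideal_eq mono_span_def)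
  moreover have "(1 :: 'k mpoly) \<in> carrier (poly_ring n)"
    by (simp add: poly_ring_def zero_in_monomials)
  ultimately show "carrier (poly_ring n :: 'k mpoly ring) \<noteq> max_ideal n" by blast
  fix p q :: "'k mpoly"
  assume pq: "p \<in> carrier (poly_ring n)" "q \<in> carrier (poly_ring n)"
    "p \<otimes>\<^bsub>poly_ring n\<^esub> q \<in> max_ideal n"
  interpret M: ideal "max_ideal n" "poly_ring n :: 'k mpoly ring" by fact
  have split: "\<exists>c r'. r = Poly_Mapping.single 0 c + r' \<and> r' \<in> max_ideal n \<and> (r \<notin> max_ideal n \<longrightarrow> c \<noteq> 0)"
    if "r \<in> carrier (poly_ring n)" for r :: "'k mpoly"
  proof -
    define c where "c = Poly_Mapping.lookup r 0"
    define r' where "r' = r - Poly_Mapping.single 0 c"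
    have r0: "Poly_Mapping.lookup r' 0 = 0"
      by (simp add: r'_def c_def lookup_minus)
    have rt: "Poly_Mapping.lookup r' t = Poly_Mapping.lookup r t" if "t \<noteq> 0" for t
      using that by (simp add: r'_def lookup_minus lookup_single)
    have "t \<in> Poly_Mapping.keys r' \<longleftrightarrow> t \<in> Poly_Mapping.keys r - {0}" for t
      using r0 rt[of t] by (cases "t = 0") (auto simp: in_keys_iff)
    then have "Poly_Mapping.keys r' = Poly_Mapping.keys r - {0}" by blast
    then have "r' \<in> max_ideal n"
      using that by (auto simp: max_ideal_eq mono_span_def poly_ring_def)
    moreover have "r = Poly_Mapping.single 0 c + r'" by (simp add: r'_def)
    ultimately show ?thesis by (intro exI[of _ c] exI[of _ r']) auto
  qed
  show "p \<in> max_ideal n \<or> q \<in> max_ideal n"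
  proof (rule ccontr)
    assume neg: "\<not> (p \<in> max_ideal n \<or> q \<in> max_ideal n)"
    obtain c p' where p: "p = Poly_Mapping.single 0 c + p'" "p' \<in> max_ideal n" "c \<noteq> 0"
      using split[OF pq(1)] neg by blast
    obtain d q' where q: "q = Poly_Mapping.single 0 d + q'" "q' \<in> max_ideal n" "d \<noteq> 0"
      using split[OF pq(2)] neg by blast
    have "Poly_Mapping.single 0 c \<in> carrier (poly_ring n)"
      by (auto simp: poly_ring_def zero_in_monomials)
    then have "Poly_Mapping.single 0 c * q' \<in> max_ideal n"
      using M.I_l_closed[OF q(2)] by simp
    moreover have "p' * q \<in> max_ideal n"
      using M.I_r_closed[OF p(2) pq(2)] by simp
    ultimately have r: "Poly_Mapping.single 0 c * q' + p' * q \<in> max_ideal n"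
      using additive_subgroup.a_closed[OF M.additive_subgroup_axioms,
          of "Poly_Mapping.single 0 c * q'" "p' * q"] by simp
    have "p * q = Poly_Mapping.single 0 (c * d) + (Poly_Mapping.single 0 c * q' + p' * q)"
      by (simp add: p(1) q(1) algebra_simps mult_single)
    moreover have "Poly_Mapping.lookup (p * q) 0 = 0"
      "Poly_Mapping.lookup (Poly_Mapping.single 0 c * q' + p' * q) 0 = 0"
      using pq(3) r by (auto simp: max_ideal_eq mono_span_def in_keys_iff subset_iff)
    ultimately have "c * d = 0" by (metis add.right_neutral lookup_add lookup_single_eq)
    then show False using p q by simp
  qed
qed

text \<open>The right-hand side describes a monomial in the socle of the quotient. If the class of
  \<open>g\<close> has annihilator \<open>max_ideal n\<close>, any term of \<open>g\<close> outside
  \<open>F\<close> supplies \<open>e\<close>, because multiplying by a variable merely shifts the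
  support. Conversely the class of \<open>mon e\<close> has the required annihilator.\<close>

lemma max_ideal_in_Ass_iff:
  assumes "absorbing n F"
  shows "max_ideal n \<in> Ass (poly_ring n :: 'k::field mpoly ring) (mono_span F) \<longleftrightarrow>
    (\<exists>e\<in>monomials n. e \<notin> F \<and> (\<forall>i\<in>{1..n}. e + Poly_Mapping.single i 1 \<in> F))"
proof -
  let ?R = "poly_ring n :: 'k mpoly ring"
  interpret J: ideal "mono_span F" ?R by (rule ideal_mono_span[OF assms])
  have carr: "carrier (?R Quot mono_span F) = (\<lambda>g. mono_span F +>\<^bsub>?R\<^esub> g) ` carrier ?R"
    by (auto simp: FactRing_def A_RCOSETS_def')
  have ann: "(mono_span F +>\<^bsub>?R\<^esub> r) \<otimes>\<^bsub>?R Quot mono_span F\<^esub> (mono_span F +>\<^bsub>?R\<^esub> g)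
      = \<zero>\<^bsub>?R Quot mono_span F\<^esub> \<longleftrightarrow> g * r \<in> mono_span F"
    if "r \<in> carrier ?R" "g \<in> carrier ?R" for r g
  proof -
    have c: "r * g \<in> carrier ?R" using J.m_closed[OF that] by simp
    have "(mono_span F +>\<^bsub>?R\<^esub> r) \<otimes>\<^bsub>?R Quot mono_span F\<^esub> (mono_span F +>\<^bsub>?R\<^esub> g)
        = mono_span F +>\<^bsub>?R\<^esub> (r * g)"
      using J.rcoset_mult_add[OF that] by (simp add: FactRing_def)
    moreover have "mono_span F +>\<^bsub>?R\<^esub> (r * g) = mono_span F \<longleftrightarrow> r * g \<in> mono_span F"
      using J.a_rcos_const J.rcos_const_imp_mem c by blast
    ultimately show ?thesis by (simp add: FactRing_def mult.commute)
  qed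
  have single: "Poly_Mapping.single i 1 \<in> monomials n \<and> Poly_Mapping.single i (1::nat) \<noteq> 0"
    if "i \<in> {1..n}" for i
    using that by (auto simp: monomials_def dest: arg_cong[of _ _ "\<lambda>f. Poly_Mapping.lookup f i"])
  show ?thesis
  proof
    assume "max_ideal n \<in> Ass ?R (mono_span F)"
    then obtain g where g: "g \<in> carrier ?R"
      and eq: "max_ideal n = {r \<in> carrier ?R. g * r \<in> mono_span F}"
      unfolding Ass_def using carr ann by (auto cong: conj_cong)
    have "(1 :: 'k mpoly) \<notin> max_ideal n" by (simp add: max_ideal_eq mono_span_def)
    then have "g \<notin> mono_span F" using eq J.one_closed by simp
    then obtain e where e: "e \<in> Poly_Mapping.keys g" "e \<notin> F" by (auto simp: mono_span_def)
    have "e + Poly_Mapping.single i 1 \<in> F" if "i \<in> {1..n}" for i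
    proof -
      have "(mon (Poly_Mapping.single i 1) :: 'k mpoly) \<in> max_ideal n"
        using single[OF that] by (simp add: max_ideal_eq)
      then have "mon (Poly_Mapping.single i 1) * g \<in> mono_span F"
        using eq by (simp add: mult.commute)
      then show ?thesis using e by (auto simp: mono_span_def keys_mon_mult add.commute)
    qed
    then show "\<exists>e\<in>monomials n. e \<notin> F \<and> (\<forall>i\<in>{1..n}. e + Poly_Mapping.single i 1 \<in> F)"
      using e g by (auto simp: poly_ring_def)
  next
    assume "\<exists>e\<in>monomials n. e \<notin> F \<and> (\<forall>i\<in>{1..n}. e + Poly_Mapping.single i 1 \<in> F)"
    then obtain e where e: "e \<in> monomials n" "e \<notin> F"
      and soc: "\<And>i. i \<in> {1..n} \<Longrightarrow> e + Poly_Mapping.single i 1 \<in> F" by blast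
    \<comment> \<open>Every monomial other than 1 is a multiple of a variable, so absorption extends
      \<open>soc\<close> to all of them.\<close>
    have soc': "e + t \<in> F" if "t \<in> monomials n" "t \<noteq> 0" for t
    proof -
      have "t \<in> multiples n ((\<lambda>i. Poly_Mapping.single i 1) ` {1..n})"
        using in_multiples_nonzero_iff that by blast
      then obtain i s where "t = Poly_Mapping.single i 1 + s" "i \<in> {1..n}" "s \<in> monomials n"
        by (auto simp: multiples_def)
      then show ?thesis using soc assms by (simp add: absorbing_def add.assoc[symmetric])
    qed
    have m: "(mon e :: 'k mpoly) \<in> carrier ?R" using e by (simp add: carrier_poly_ring)
    have "max_ideal n = {r \<in> carrier ?R. mon e * r \<in> mono_span F}"
    proof (intro equalityI subsetI)
      fix r :: "'k mpoly"
      assume "r \<in> max_ideal n"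
      then show "r \<in> {r \<in> carrier ?R. mon e * r \<in> mono_span F}"
        using soc' by (auto simp: max_ideal_eq mono_span_def keys_mon_mult poly_ring_def)
    next
      fix r :: "'k mpoly"
      assume "r \<in> {r \<in> carrier ?R. mon e * r \<in> mono_span F}"
      \<comment> \<open>A nonzero constant term of \<open>r\<close> would put \<open>e\<close> into
        the support of \<open>mon e * r\<close>, hence into \<open>F\<close>.\<close>
      then show "r \<in> max_ideal n"
        using e by (auto simp: max_ideal_eq mono_span_def keys_mon_mult poly_ring_def)
    qed
    then have "max_ideal n = {r \<in> carrier ?R.
        (mono_span F +>\<^bsub>?R\<^esub> r) \<otimes>\<^bsub>?R Quot mono_span F\<^esub> (mono_span F +>\<^bsub>?R\<^esub> mon e)
      = \<zero>\<^bsub>?R Quot mono_span F\<^esub>}"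
      using ann m by (auto cong: conj_cong)
    then show "max_ideal n \<in> Ass ?R (mono_span F)"
      unfolding Ass_def using carr m primeideal_max_ideal by blast
  qed
qed

section \<open>Degrees and minimal generators\<close>

lemma mono_degree_eq:
  assumes "t \<in> monomials n"
  shows "mono_degree t = (\<Sum>s=1..n. Poly_Mapping.lookup t s)"
  unfolding mono_degree_def
  by (rule sum.mono_neutral_left) (use assms in \<open>auto simp: monomials_def in_keys_iff\<close>)

lemma mono_degree_add:
  assumes "s \<in> monomials n" "t \<in> monomials n"
  shows "mono_degree (s + t) = mono_degree s + mono_degree t"
  using assms by (simp add: mono_degree_eq[of _ n] monomials_add lookup_add sum.distrib)

lemma mono_degree_0_iff: "mono_degree t = 0 \<longleftrightarrow> t = 0"
proof
  assume "mono_degree t = 0"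
  then have "Poly_Mapping.lookup t s = 0" for s
    by (cases "s \<in> Poly_Mapping.keys t") (auto simp: mono_degree_def in_keys_iff)
  then show "t = 0" by (intro poly_mapping_eqI) simp
qed (simp add: mono_degree_def)

text \<open>The elements of \<open>F\<close> that are minimal under divisibility; for absorbing
  \<open>F\<close> they form \<open>G(I)\<close> with \<open>I = mono_span F\<close>.\<close>

definition primitive :: "nat \<Rightarrow> monomial set \<Rightarrow> monomial set" where
  "primitive n F = {a \<in> F. \<forall>b\<in>F. \<forall>s\<in>monomials n. a = b + s \<longrightarrow> s = 0}"

text \<open>Induction on the degree: a monomial that is not primitive is a proper multiple of one in
  \<open>F\<close> of smaller degree.\<close>

lemma multiples_primitive:
  assumes "absorbing n F"
  shows "multiples n (primitive n F) = F"
proof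
  show "multiples n (primitive n F) \<subseteq> F"
    using assms by (auto simp: multiples_def primitive_def absorbing_def)
  show "F \<subseteq> multiples n (primitive n F)"
  proof
    fix a assume "a \<in> F"
    then show "a \<in> multiples n (primitive n F)"
    proof (induction "mono_degree a" arbitrary: a rule: less_induct)
      case less
      show ?case
      proof (cases "a \<in> primitive n F")
        case True
        then show ?thesis using subset_multiples by blast
      next
        case False
        then obtain b s where b: "b \<in> F" "s \<in> monomials n" "a = b + s" "s \<noteq> 0"
          using less.prems by (auto simp: primitive_def)
        then have "b \<in> monomials n" using assms by (auto simp: absorbing_def)
        then have "mono_degree b < mono_degree a"
          using b mono_degree_0_iff[of s] by (simp add: mono_degree_add)
        then have "b \<in> multiples n (primitive n F)" using less.hyps b by blast
        moreover have "absorbing n (multiples n (primitive n F))"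
          using assms by (intro absorbing_multiples) (auto simp: primitive_def absorbing_def)
        ultimately show ?thesis using b by (simp add: absorbing_def)
      qed
    qed
  qed
qed

text \<open>A primitive monomial equals \<open>b + s\<close> with \<open>b\<close> a generator only
  if \<open>s = 0\<close>. So every monomial generating set contains \<open>primitive n F\<close>,
  which itself generates; this resolves the \<open>THE\<close> in \<open>min_gens\<close>.\<close>

lemma minimal_monomial_generators_iff:
  assumes "absorbing n F"
  shows "minimal_monomial_generators n (mono_span F :: 'k::field mpoly set) A \<longleftrightarrow> A = primitive n F"
proof -
  let ?P = "primitive n F"
  have sub: "?P \<subseteq> monomials n" using assms by (auto simp: primitive_def absorbing_def)
  have least: "?P \<subseteq> B" if B: "multiples n B = F" for B
  proof
    fix a assume a: "a \<in> ?P"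
    then obtain b s where "a = b + s" "b \<in> B" "s \<in> monomials n"
      using B by (auto simp: primitive_def multiples_def)
    moreover have "b \<in> F" using \<open>b \<in> B\<close> B subset_multiples by blast
    ultimately show "a \<in> B" using a by (auto simp: primitive_def)
  qed
  have gen: "Idl\<^bsub>poly_ring n\<^esub> (mon ` B) = (mono_span F :: 'k mpoly set) \<longleftrightarrow> multiples n B = F"
    if "B \<subseteq> monomials n" for B
    using Idl_mon[OF that, where 'k='k] mono_span_inject[where 'k='k, of "multiples n B" F] by simp
  show ?thesis
  proof
    assume A: "minimal_monomial_generators n (mono_span F :: 'k mpoly set) A"
    then have "multiples n A = F"
      using gen by (auto simp: minimal_monomial_generators_def)
    then have "?P \<subseteq> A" by (rule least)
    moreover have "\<not> ?P \<subset> A"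
      using A gen[OF sub] multiples_primitive[OF assms] unfolding minimal_monomial_generators_def by blast
    ultimately show "A = ?P" by blast
  next
    assume A: "A = ?P"
    have "Idl\<^bsub>poly_ring n\<^esub> (mon ` B) \<noteq> (mono_span F :: 'k mpoly set)" if "B \<subset> ?P" for B
      using gen[of B] least[of B] that sub by blast
    then show "minimal_monomial_generators n (mono_span F :: 'k mpoly set) A"
      unfolding minimal_monomial_generators_def A
      using sub gen[OF sub] multiples_primitive[OF assms] by blast
  qed
qed

lemma min_gens_mono_span:
  "absorbing n F \<Longrightarrow> min_gens n (mono_span F :: 'k::field mpoly set) = primitive n F"
  by (simp add: min_gens_def minimal_monomial_generators_iff)

text \<open>Equal degrees leave no room for a nonzero cofactor between generators.\<close>

lemma primitive_multiples:
  assumes "B \<subseteq> monomials n" "\<And>b. b \<in> B \<Longrightarrow> mono_degree b = d"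
  shows "primitive n (multiples n B) = B"
proof
  show "primitive n (multiples n B) \<subseteq> B"
  proof
    fix a assume a: "a \<in> primitive n (multiples n B)"
    then obtain b s where "a = b + s" "b \<in> B" "s \<in> monomials n"
      by (auto simp: primitive_def multiples_def)
    moreover have "b \<in> multiples n B" using \<open>b \<in> B\<close> subset_multiples by blast
    ultimately show "a \<in> B" using a by (auto simp: primitive_def)
  qed
  show "B \<subseteq> primitive n (multiples n B)"
  proof
    fix a assume a: "a \<in> B"
    have "s = 0" if "c \<in> multiples n B" "s \<in> monomials n" "a = c + s" for c s
    proof -
      obtain b r where br: "c = b + r" "b \<in> B" "r \<in> monomials n"
        using \<open>c \<in> multiples n B\<close> by (auto simp: multiples_def)
      have b: "b \<in> monomials n" using assms(1) br by blast
      have "mono_degree a = mono_degree b + mono_degree r + mono_degree s"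
        unfolding that(3) br(1)
        using mono_degree_add[OF monomials_add[OF b br(3)] that(2)] mono_degree_add[OF b br(3)] by simp
      then have "mono_degree s = 0" using assms(2) a br by fastforce
      then show "s = 0" by (simp add: mono_degree_0_iff)
    qed
    moreover have "a \<in> multiples n B" using a subset_multiples by blast
    ultimately show "a \<in> primitive n (multiples n B)" by (auto simp: primitive_def)
  qed
qed

section \<open>Monomials with prescribed prefix sums, and the Borel order\<close>

definition mono_of :: "nat \<Rightarrow> (nat \<Rightarrow> nat) \<Rightarrow> monomial" where
  "mono_of n f = (\<Sum>s=1..n. Poly_Mapping.single s (f s))"

lemma lookup_mono_of:
  "Poly_Mapping.lookup (mono_of n f) s = (if s \<in> {1..n} then f s else 0)"
proof -
  have "Poly_Mapping.lookup (mono_of n f) s = (\<Sum>r=1..n. if r = s then f r else 0)"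
    by (auto simp: mono_of_def lookup_sum lookup_single when_def intro!: sum.cong)
  then show ?thesis by simp
qed

lemma mono_of_in_monomials: "mono_of n f \<in> monomials n"
  by (auto simp: monomials_def in_keys_iff lookup_mono_of split: if_splits)

lemma sum_lookup_mono_of:
  "j \<le> n \<Longrightarrow> (\<Sum>s=1..j. h (Poly_Mapping.lookup (mono_of n f) s)) = (\<Sum>s=1..j. h (f s))"
  by (rule sum.cong) (auto simp: lookup_mono_of)

lemma monomial_cofactor:
  assumes "e \<in> monomials n" "\<And>s. Poly_Mapping.lookup w s \<le> Poly_Mapping.lookup e s"
  shows "e = w + (e - w)" "e - w \<in> monomials n"
proof -
  show "e = w + (e - w)"
    by (rule poly_mapping_eqI) (use assms(2) in \<open>simp add: lookup_add lookup_minus\<close>)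
  then show "e - w \<in> monomials n" using assms(1) monomials_addD by metis
qed

text \<open>Monotonicity keeps the truncated differences exact. Together with \<open>mono_of\<close>
  this yields a monomial with a prescribed sequence of prefix sums.\<close>

lemma sum_telescope_nat:
  fixes g :: "nat \<Rightarrow> nat"
  assumes "g 0 = 0" "mono g"
  shows "(\<Sum>s=1..j. g s - g (s - 1)) = g j"
proof (induction j)
  case (Suc j)
  have "g j \<le> g (Suc j)" using assms(2) by (simp add: mono_def)
  then show ?case using Suc by simp
qed (simp add: assms)

lemma mono_prefix_sum:
  fixes f :: "nat \<Rightarrow> nat"
  shows "mono (\<lambda>j. \<Sum>s=1..j. f s)"
  by (intro monoI sum_mono2) auto

text \<open>Dominance of prefix sums is the Borel order: \<open>w\<close> is reached from
  \<open>v\<close> by exchanges that replace a variable by one of smaller index. The induction is on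
  the total deficit of the prefix sums of \<open>v\<close> against those of \<open>w\<close>; each
  exchange lowers it while preserving dominance.\<close>

lemma borel_closure:
  assumes closed: "\<And>v p q. v \<in> G \<Longrightarrow> 1 \<le> p \<Longrightarrow> p < q \<Longrightarrow> q \<le> n \<Longrightarrow> q \<in> Poly_Mapping.keys v \<Longrightarrow>
      p \<notin> Poly_Mapping.keys v \<Longrightarrow> Poly_Mapping.single p 1 + (v - Poly_Mapping.single q 1) \<in> G"
    and G: "\<And>v. v \<in> G \<Longrightarrow> v \<in> monomials n \<and> squarefree_mono v \<and> mono_degree v = d"
    and w: "w \<in> monomials n" "squarefree_mono w" "mono_degree w = d"
    and v: "v \<in> G"
    and dom: "\<And>j. (\<Sum>s=1..j. Poly_Mapping.lookup v s) \<le> (\<Sum>s=1..j. Poly_Mapping.lookup w s)"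
  shows "w \<in> G"
  using v dom
proof (induction "\<Sum>j=1..n. (\<Sum>s=1..j. Poly_Mapping.lookup w s) - (\<Sum>s=1..j. Poly_Mapping.lookup v s)"
    arbitrary: v rule: less_induct)
  case less
  let ?V = "\<lambda>j. \<Sum>s=1..j. Poly_Mapping.lookup v s"
  let ?W = "\<lambda>j. \<Sum>s=1..j. Poly_Mapping.lookup w s"
  have v: "v \<in> monomials n" "squarefree_mono v" "mono_degree v = d" using G less.prems by auto
  show ?case
  proof (cases "v = w")
    case False
    then obtain r where "Poly_Mapping.lookup v r \<noteq> Poly_Mapping.lookup w r"
      by (meson poly_mapping_eqI)
    \<comment> \<open>The first disagreement. Dominance and squarefreeness force exponent 0 in
      \<open>v\<close> and 1 in \<open>w\<close> there.\<close>
    define p where "p = (LEAST r. Poly_Mapping.lookup v r \<noteq> Poly_Mapping.lookup w r)"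
    have pne: "Poly_Mapping.lookup v p \<noteq> Poly_Mapping.lookup w p"
      unfolding p_def by (rule LeastI) fact
    have peq: "Poly_Mapping.lookup v r = Poly_Mapping.lookup w r" if "r < p" for r
      using not_less_Least[OF that[unfolded p_def]] by simp
    have p: "p \<in> {1..n}"
    proof -
      have "p \<in> Poly_Mapping.keys v \<union> Poly_Mapping.keys w" using pne by (auto simp: in_keys_iff)
      then show ?thesis using v(1) w(1) by (auto simp: monomials_def)
    qed
    have split: "(\<Sum>s=1..p. f s) = (\<Sum>s=1..<p. f s) + f p" for f :: "nat \<Rightarrow> nat"
      using p by (cases p) (auto simp: atLeastLessThanSuc_atLeastAtMost)
    have "(\<Sum>s=1..<p. Poly_Mapping.lookup v s) = (\<Sum>s=1..<p. Poly_Mapping.lookup w s)"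
      by (rule sum.cong) (auto simp: peq)
    then have "Poly_Mapping.lookup v p \<le> Poly_Mapping.lookup w p"
      and VW: "?W p - ?V p = Poly_Mapping.lookup w p - Poly_Mapping.lookup v p"
      using less.prems(2)[of p] unfolding split[of "Poly_Mapping.lookup v"] split[of "Poly_Mapping.lookup w"] by linarith+
    moreover have "Poly_Mapping.lookup w p \<le> 1" using w(2) by (simp add: squarefree_mono_def)
    ultimately have vp: "Poly_Mapping.lookup v p = 0" and wp: "Poly_Mapping.lookup w p = 1"
      using pne by linarith+
    then have Wp: "?W p = ?V p + 1" using VW by linarith
    \<comment> \<open>Otherwise \<open>v\<close> would be complete at \<open>p\<close>, where
      \<open>w\<close> already has a larger prefix sum, contradicting equal degrees.\<close>
    have "\<exists>q>p. Poly_Mapping.lookup v q \<noteq> 0"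
    proof (rule ccontr)
      assume "\<not> (\<exists>q>p. Poly_Mapping.lookup v q \<noteq> 0)"
      then have "?V n = ?V p"
        using p by (intro sum.mono_neutral_right) auto
      moreover have "?W p \<le> ?W n" using p by (intro sum_mono2) auto
      moreover have "?V n = d" "?W n = d"
        using mono_degree_eq[OF v(1)] mono_degree_eq[OF w(1)] v(3) w(3) by simp_all
      ultimately show False using Wp by simp
    qed
    \<comment> \<open>The next variable of \<open>v\<close> after \<open>p\<close>: the prefix sums
      of \<open>v\<close> stay constant from \<open>p\<close> up to \<open>q - 1\<close>, which
      leaves room to raise them by one there.\<close>
    define q where "q = (LEAST q. p < q \<and> Poly_Mapping.lookup v q \<noteq> 0)"
    have q: "p < q" "Poly_Mapping.lookup v q \<noteq> 0"
      using LeastI_ex[OF \<open>\<exists>q>p. Poly_Mapping.lookup v q \<noteq> 0\<close>] by (auto simp: q_def)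
    have qz: "Poly_Mapping.lookup v r = 0" if "p < r" "r < q" for r
      using not_less_Least[of r "\<lambda>q. p < q \<and> Poly_Mapping.lookup v q \<noteq> 0"] that by (auto simp: q_def)
    have qn: "q \<le> n" using q v(1) by (auto simp: monomials_def in_keys_iff subset_iff)
    have vq: "Poly_Mapping.lookup v q = 1"
      using q(2) v(2)[unfolded squarefree_mono_def, rule_format, of q] by linarith
    define v' where "v' = Poly_Mapping.single p 1 + (v - Poly_Mapping.single q 1)"
    have v': "v' \<in> G"
      unfolding v'_def using closed[OF less.prems(1), of p q] p q qn vp by (auto simp: in_keys_iff)
    \<comment> \<open>Both corrections are added rather than subtracted, which avoids truncated
      subtraction.\<close>
    have shift: "(\<Sum>s=1..j. Poly_Mapping.lookup v' s) + (if q \<le> j then 1 else 0) = ?V j + (if p \<le> j then 1 else 0)" for j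
    proof -
      have "Poly_Mapping.lookup v' s + (if q = s then 1 else 0)
          = Poly_Mapping.lookup v s + (if p = s then 1 else 0)" for s
        using vq by (auto simp: v'_def lookup_add lookup_minus lookup_single when_def)
      then have "(\<Sum>s=1..j. Poly_Mapping.lookup v' s + (if q = s then 1 else 0))
          = (\<Sum>s=1..j. Poly_Mapping.lookup v s + (if p = s then 1 else 0))" by simp
      then show ?thesis using p q by (simp add: sum.distrib)
    qed
    have V': "(\<Sum>s=1..j. Poly_Mapping.lookup v' s) = ?V j + (if p \<le> j \<and> j < q then 1 else 0)" for j
      using shift[of j] q(1) by (cases "p \<le> j"; cases "q \<le> j") auto
    have gap: "?V j + 1 \<le> ?W j" if "p \<le> j" "j < q" for j
    proof -
      have "?V j = ?V p" using that qz by (intro sum.mono_neutral_right) auto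
      moreover have "?W p \<le> ?W j" using that by (intro sum_mono2) auto
      ultimately show ?thesis using Wp by simp
    qed
    show ?thesis
    proof (rule less.hyps[OF _ v'])
      show "(\<Sum>s=1..j. Poly_Mapping.lookup v' s) \<le> ?W j" for j
        unfolding V' using gap[of j] less.prems(2)[of j] by simp
      show "(\<Sum>j=1..n. ?W j - (\<Sum>s=1..j. Poly_Mapping.lookup v' s)) < (\<Sum>j=1..n. ?W j - ?V j)"
      proof (rule sum_strict_mono_ex1)
        show "\<exists>j\<in>{1..n}. ?W j - (\<Sum>s=1..j. Poly_Mapping.lookup v' s) < ?W j - ?V j"
          using p q(1) Wp unfolding V' by (intro bexI[of _ p]) auto
      qed (unfold V', auto)
    qed
  qed (use less.prems in simp)
qed

section \<open>Powers of a squarefree Borel ideal\<close>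

locale borel_exponents =
  fixes n d :: nat and i :: "nat \<Rightarrow> nat"
  assumes d_pos: "d \<ge> 1" and smono: "strict_mono_on {1..d} i" and i_1: "1 < i 1" and i_d: "i d = n"
begin

lemma i_less: "r \<in> {1..d} \<Longrightarrow> t \<in> {1..d} \<Longrightarrow> r < t \<Longrightarrow> i r < i t"
  using smono by (auto simp: strict_mono_on_def)

lemma i_le_n: "t \<in> {1..d} \<Longrightarrow> i t \<le> n"
  using i_less[of t d] i_d d_pos by (cases "t = d") auto

lemma i_less_n: "t \<in> {1..<d} \<Longrightarrow> i t < n"
  using i_less[of t d] i_d d_pos by auto

text \<open>Strict growth starting above 1. It also ensures that the natural-number difference
  \<open>i t - t\<close> never truncates.\<close>

lemma less_i: "t \<in> {1..d} \<Longrightarrow> t < i t"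
proof (induction t)
  case (Suc t)
  then show ?case using i_1 i_less[of t "Suc t"] by (cases "t = 0") auto
qed simp

text \<open>The intended monomials of the \<open>k\<close>-th power. Exponents are capped at
  \<open>k\<close> because each of the \<open>k\<close> squarefree factors can use a variable at
  most once.\<close>

definition power_monomials :: "nat \<Rightarrow> monomial set" where
  "power_monomials k = {e \<in> monomials n.
     \<forall>t\<in>{1..d}. k * t \<le> (\<Sum>s=1..i t. min (Poly_Mapping.lookup e s) k)}"

text \<open>The explicit \<open>G(I)\<close>: having at least \<open>t\<close> variables among the
  first \<open>i t\<close> means that the \<open>t\<close>-th smallest index is at most
  \<open>i t\<close>.\<close>

definition borel_gens :: "monomial set" where
  "borel_gens = {w \<in> monomials n. squarefree_mono w \<and> mono_degree w = d \<and>
     (\<forall>t\<in>{1..d}. t \<le> (\<Sum>s=1..i t. Poly_Mapping.lookup w s))}"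

lemma absorbing_power_monomials: "absorbing n (power_monomials k)"
proof -
  have "e + f \<in> power_monomials k" if "e \<in> power_monomials k" "f \<in> monomials n" for e f
  proof -
    have "(\<Sum>s=1..i t. min (Poly_Mapping.lookup e s) k) \<le> (\<Sum>s=1..i t. min (Poly_Mapping.lookup (e + f) s) k)" for t
      by (rule sum_mono) (auto simp: lookup_add)
    then show ?thesis
      using that monomials_add unfolding power_monomials_def by (auto intro: order_trans)
  qed
  then show ?thesis by (auto simp: absorbing_def power_monomials_def)
qed

lemma multiples_borel_gens: "multiples n borel_gens = power_monomials 1"
proof
  have "borel_gens \<subseteq> power_monomials 1"
  proof
    fix w assume w: "w \<in> borel_gens"
    then have "min (Poly_Mapping.lookup w s) 1 = Poly_Mapping.lookup w s" for s
      by (auto simp: borel_gens_def squarefree_mono_def min_absorb1)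
    then show "w \<in> power_monomials 1" using w by (simp add: borel_gens_def power_monomials_def)
  qed
  then show "multiples n borel_gens \<subseteq> power_monomials 1"
    using absorbing_power_monomials[of 1] by (auto simp: multiples_def absorbing_def)
  show "power_monomials 1 \<subseteq> multiples n borel_gens"
  proof
    fix e assume e: "e \<in> power_monomials 1"
    define c where "c s = min (Poly_Mapping.lookup e s) 1" for s
    \<comment> \<open>Capping the prefix sums at \<open>d\<close> keeps just the first
      \<open>d\<close> variables dividing the monomial; the inequalities survive since they only
      concern \<open>t \<le> d\<close>.\<close>
    define g where "g j = min (\<Sum>s=1..j. c s) d" for j
    define w where "w = mono_of n (\<lambda>s. g s - g (s - 1))"
    have g: "g 0 = 0" "mono g"
      using monoD[OF mono_prefix_sum[of c]] d_pos
      by (auto simp: g_def intro!: monoI) (meson min.coboundedI1)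
    have lw: "Poly_Mapping.lookup w s \<le> c s" for s
    proof (cases s)
      case (Suc r)
      then show ?thesis by (auto simp: w_def lookup_mono_of g_def)
    qed (simp add: w_def lookup_mono_of)
    have sums: "(\<Sum>s=1..j. Poly_Mapping.lookup w s) = g j" if "j \<le> n" for j
      unfolding w_def using sum_lookup_mono_of[OF that, of "\<lambda>x. x"] sum_telescope_nat[OF g] by simp
    have bound: "t \<le> g (i t)" if "t \<in> {1..d}" for t
      using e that by (auto simp: power_monomials_def g_def c_def)
    have "w \<in> borel_gens"
      unfolding borel_gens_def
    proof (intro CollectI conjI ballI)
      show w: "w \<in> monomials n" by (simp add: w_def mono_of_in_monomials)
      show "squarefree_mono w"
        using lw by (auto simp: squarefree_mono_def c_def)
      have "g n \<le> d" by (simp add: g_def)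
      then show "mono_degree w = d"
        using mono_degree_eq[OF w] sums[of n] bound[of d] d_pos i_d by simp
      show "t \<le> (\<Sum>s=1..i t. Poly_Mapping.lookup w s)" if "t \<in> {1..d}" for t
        using that sums[OF i_le_n] bound by simp
    qed
    moreover have "e \<in> monomials n" using e by (simp add: power_monomials_def)
    moreover have "Poly_Mapping.lookup w s \<le> Poly_Mapping.lookup e s" for s
      using lw[of s] by (simp add: c_def)
    ultimately show "e \<in> multiples n borel_gens"
      unfolding multiples_def using monomial_cofactor[of e n w] by blast
  qed
qed

text \<open>Products satisfy the inequalities because the capped exponents \<open>min x k\<close>
  and \<open>min y 1\<close> add up to at most \<open>min (x + y) (Suc k)\<close>. Conversely, the
  generator split off must use every variable whose capped exponent is \<open>Suc k\<close>, and
  must leave enough of each prefix sum; rounding achieves both.\<close>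

lemma power_monomials_Suc:
  "power_monomials (Suc k) = {s + t |s t. s \<in> power_monomials k \<and> t \<in> power_monomials 1}"
proof (intro equalityI subsetI)
  fix x assume "x \<in> {s + t |s t. s \<in> power_monomials k \<and> t \<in> power_monomials 1}"
  then obtain e f where x: "x = e + f" and e: "e \<in> power_monomials k" and f: "f \<in> power_monomials 1"
    by blast
  have "Suc k * t \<le> (\<Sum>s=1..i t. min (Poly_Mapping.lookup x s) (Suc k))" if "t \<in> {1..d}" for t
  proof -
    have "k * t \<le> (\<Sum>s=1..i t. min (Poly_Mapping.lookup e s) k)"
      "1 * t \<le> (\<Sum>s=1..i t. min (Poly_Mapping.lookup f s) 1)"
      using e f that unfolding power_monomials_def by blast+
    then have "Suc k * t \<le> (\<Sum>s=1..i t. min (Poly_Mapping.lookup e s) k) + (\<Sum>s=1..i t. min (Poly_Mapping.lookup f s) 1)"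
      by simp
    also have "\<dots> \<le> (\<Sum>s=1..i t. min (Poly_Mapping.lookup x s) (Suc k))"
      unfolding sum.distrib[symmetric] by (rule sum_mono) (auto simp: x lookup_add)
    finally show ?thesis .
  qed
  then show "x \<in> power_monomials (Suc k)"
    using e f monomials_add by (auto simp: power_monomials_def x)
next
  fix e assume e: "e \<in> power_monomials (Suc k)"
  define c where "c s = min (Poly_Mapping.lookup e s) (Suc k)" for s
  define C where "C j = (\<Sum>s=1..j. c s)" for j
  define f where "f s = C s div Suc k - C (s - 1) div Suc k" for s
  define w where "w = mono_of n f"
  \<comment> \<open>\<open>f s\<close> counts the multiples of \<open>Suc k\<close> above
    \<open>C (s - 1)\<close> and up to \<open>C s\<close>. This range has length
    \<open>c s \<le> Suc k\<close>, so it contains at most one, none if it is empty, and exactly one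
    if it has full length.\<close>
  have fc: "f s \<le> 1 \<and> f s \<le> c s \<and> (c s = Suc k \<longrightarrow> f s = 1)" if "s \<ge> 1" for s
  proof -
    obtain r where r: "s = Suc r" using \<open>s \<ge> 1\<close> by (cases s) auto
    have Cs: "C s = C (s - 1) + c s" by (simp add: C_def r)
    have "c s \<le> Suc k" by (simp add: c_def)
    then consider "c s = 0" | "c s = Suc k" | "1 \<le> c s" "c s < Suc k" by linarith
    then show ?thesis
    proof cases
      case 1 then show ?thesis using Cs by (simp add: f_def)
    next
      case 2
      have "(C (s - 1) + Suc k) div Suc k = C (s - 1) div Suc k + 1"
        by (rule div_add_self2) simp
      then have "f s = 1" unfolding f_def Cs 2 by linarith
      then show ?thesis using 2 by simp
    next
      case 3
      have "C s div Suc k \<le> (C (s - 1) + Suc k) div Suc k"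
        using 3 Cs by (intro div_le_mono) simp
      also have "\<dots> = C (s - 1) div Suc k + 1" by (rule div_add_self2) simp
      finally have "f s \<le> 1" unfolding f_def by linarith
      then show ?thesis using 3 by simp
    qed
  qed
  have g: "(\<lambda>j. C j div Suc k) 0 = 0" "mono (\<lambda>j. C j div Suc k)"
    using monoD[OF mono_prefix_sum[of c]] by (auto simp: C_def intro!: monoI div_le_mono)
  have sumf: "(\<Sum>s=1..j. f s) = C j div Suc k" for j
    unfolding f_def by (rule sum_telescope_nat[OF g])
  have Ct: "Suc k * t \<le> C (i t)" if "t \<in> {1..d}" for t
    using e that by (auto simp: power_monomials_def C_def c_def)
  then have ft: "t \<le> C (i t) div Suc k" if "t \<in> {1..d}" for t
    using that by (metis less_eq_div_iff_mult_less_eq mult.commute zero_less_Suc)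
  have lw: "Poly_Mapping.lookup w s = (if s \<in> {1..n} then f s else 0)" for s
    by (simp add: w_def lookup_mono_of)
  have w: "w \<in> power_monomials 1"
    unfolding power_monomials_def
  proof (intro CollectI conjI ballI)
    show "w \<in> monomials n" by (simp add: w_def mono_of_in_monomials)
    fix t assume t: "t \<in> {1..d}"
    have "(\<Sum>s=1..i t. min (Poly_Mapping.lookup w s) 1) = (\<Sum>s=1..i t. f s)"
      using i_le_n[OF t] fc by (intro sum.cong) (auto simp: lw min_absorb1)
    then show "1 * t \<le> (\<Sum>s=1..i t. min (Poly_Mapping.lookup w s) 1)"
      using ft[OF t] sumf by simp
  qed
  have "e \<in> monomials n" using e by (simp add: power_monomials_def)
  moreover have "Poly_Mapping.lookup w s \<le> Poly_Mapping.lookup e s" for s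
    using fc[of s] by (auto simp: lw c_def)
  ultimately have ew: "e = w + (e - w)" "e - w \<in> monomials n"
    using monomial_cofactor by blast+
  have "e - w \<in> power_monomials k"
    unfolding power_monomials_def
  proof (intro CollectI conjI ballI ew(2))
    fix t assume t: "t \<in> {1..d}"
    define q where "q = C (i t) div Suc k"
    \<comment> \<open>The split-off part takes \<open>q\<close> out of the prefix sum, and at least
      \<open>k * q\<close> with \<open>q \<ge> t\<close> remains.\<close>
    have "Suc k * q \<le> C (i t)" unfolding q_def by (rule times_div_less_eq_dividend)
    then have "k * q \<le> C (i t) - q" by simp
    moreover have "k * t \<le> k * q" using ft[OF t] by (simp add: q_def)
    ultimately have "k * t \<le> C (i t) - (\<Sum>s=1..i t. f s)" unfolding sumf q_def by linarith
    also have "\<dots> = (\<Sum>s=1..i t. c s - f s)"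
      unfolding C_def using fc by (intro sum_subtractf_nat[symmetric]) auto
    also have "\<dots> \<le> (\<Sum>s=1..i t. min (Poly_Mapping.lookup (e - w) s) k)"
    proof (rule sum_mono)
      fix s assume s: "s \<in> {1..i t}"
      have "c s \<le> Suc k" "c s \<le> Poly_Mapping.lookup e s" by (auto simp: c_def)
      moreover have "Poly_Mapping.lookup w s = f s" using s i_le_n[OF t] by (auto simp: lw)
      ultimately show "c s - f s \<le> min (Poly_Mapping.lookup (e - w) s) k"
        using fc[of s] s by (cases "c s = Suc k") (auto simp: lookup_minus)
    qed
    finally show "k * t \<le> (\<Sum>s=1..i t. min (Poly_Mapping.lookup (e - w) s) k)" .
  qed
  then show "e \<in> {s + t |s t. s \<in> power_monomials k \<and> t \<in> power_monomials 1}"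
    using ew(1) w by (intro CollectI exI[of _ "e - w"] exI[of _ w]) (simp add: add.commute)
qed

lemma ideal_power:
  "(mono_span (power_monomials 1) :: 'k::field mpoly set) [^]\<^bsub>ideals_set (poly_ring n)\<^esub> (k::nat)
    = mono_span (power_monomials k)"
proof (induction k)
  case 0
  \<comment> \<open>For exponent 0 all inequalities are trivial, matching the whole ring as the unit
    of \<open>ideals_set\<close>.\<close>
  have "power_monomials 0 = monomials n" by (auto simp: power_monomials_def)
  then show ?case by (simp add: nat_pow_def ideals_set_def carrier_poly_ring)
next
  case (Suc k)
  have "(mono_span (power_monomials 1) :: 'k mpoly set) [^]\<^bsub>ideals_set (poly_ring n)\<^esub> Suc k
      = ideal_prod (poly_ring n) (mono_span (power_monomials 1) [^]\<^bsub>ideals_set (poly_ring n)\<^esub> k)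
          (mono_span (power_monomials 1))"
    by (simp add: nat_pow_def ideals_set_def)
  then show ?case
    unfolding Suc power_monomials_Suc
    by (simp add: ideal_prod_mono_span absorbing_power_monomials)
qed

text \<open>Shifting the power to \<open>Suc k\<close> makes \<open>k\<close> the largest exponent
  allowed in a socle monomial. Necessity bounds each prefix by exponents \<open>k\<close>;
  sufficiency fills the variables from the left.\<close>

lemma socle_iff:
  "(\<exists>e\<in>monomials n. e \<notin> power_monomials (Suc k) \<and>
      (\<forall>s\<in>{1..n}. e + Poly_Mapping.single s 1 \<in> power_monomials (Suc k)))
    \<longleftrightarrow> (\<forall>t\<in>{1..<d}. t \<le> k * (i t - t))" (is "?L \<longleftrightarrow> ?R")
proof
  assume ?L
  then obtain e where e: "e \<in> monomials n" "e \<notin> power_monomials (Suc k)"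
    and soc: "\<And>s. s \<in> {1..n} \<Longrightarrow> e + Poly_Mapping.single s 1 \<in> power_monomials (Suc k)" by blast
  let ?S = "\<lambda>e j. \<Sum>s=1..j. min (Poly_Mapping.lookup e s) (Suc k)"
  have n: "n \<in> {1..n}" using less_i[of d] i_d d_pos by auto
  \<comment> \<open>The variable with index \<open>n\<close> lies beyond the prefix ending at
    \<open>i t\<close>, so multiplying by it leaves this sum unchanged.\<close>
  have ineq: "Suc k * t \<le> ?S e (i t)" if "t \<in> {1..<d}" for t
  proof -
    have "Suc k * t \<le> ?S (e + Poly_Mapping.single n 1) (i t)"
      using soc[OF n] that by (auto simp: power_monomials_def)
    also have "\<dots> = ?S e (i t)"
      using i_less_n[OF that] by (intro sum.cong) (auto simp: lookup_add lookup_single)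
    finally show ?thesis .
  qed
  then have less: "?S e n < Suc k * d"
  proof -
    obtain t where "t \<in> {1..d}" "\<not> Suc k * t \<le> ?S e (i t)"
      using e by (auto simp: power_monomials_def)
    moreover from this have "t = d" using ineq[of t] by (cases "t = d") auto
    ultimately show ?thesis using i_d by simp
  qed
  \<comment> \<open>An exponent already above \<open>k\<close> is capped, so raising it could not
    repair the failing inequality at \<open>d\<close>.\<close>
  have le: "Poly_Mapping.lookup e s \<le> k" if "s \<in> {1..n}" for s
  proof (rule ccontr)
    assume *: "\<not> Poly_Mapping.lookup e s \<le> k"
    have "Suc k * d \<le> ?S (e + Poly_Mapping.single s 1) n"
      using soc[OF that] d_pos i_d by (auto simp: power_monomials_def)
    also have "\<dots> = ?S e n"
      using * by (intro sum.cong) (auto simp: lookup_add lookup_single when_def)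
    finally show False using less by simp
  qed
  show ?R
  proof
    fix t assume t: "t \<in> {1..<d}"
    have "Suc k * t \<le> ?S e (i t)" by (rule ineq[OF t])
    also have "\<dots> \<le> (\<Sum>s=1..i t. k)"
      using le i_less_n[OF t] by (intro sum_mono) (auto simp: min.coboundedI1)
    finally have "Suc k * t \<le> k * i t" by (simp add: mult.commute)
    then show "t \<le> k * (i t - t)" by (simp add: diff_mult_distrib2)
  qed
next
  assume R: ?R
  \<comment> \<open>Exponent \<open>k\<close> from the first variable on, until the total reaches
    \<open>Suc k * d - 1\<close>, one short of what membership requires.\<close>
  define g where "g j = min (k * j) (Suc k * d - 1)" for j
  have g: "g 0 = 0" "mono g"
    by (auto simp: g_def intro!: monoI) (meson min.coboundedI1 mult_le_mono2)
  define e where "e = mono_of n (\<lambda>s. g s - g (s - 1))"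
  have le: "Poly_Mapping.lookup e s \<le> k" for s
  proof (cases s)
    case (Suc r)
    then show ?thesis by (auto simp: e_def lookup_mono_of g_def min_def)
  qed (simp add: e_def lookup_mono_of)
  have sums: "(\<Sum>s=1..j. Poly_Mapping.lookup e s) = g j" if "j \<le> n" for j
    unfolding e_def using sum_lookup_mono_of[OF that, of "\<lambda>x. x"] sum_telescope_nat[OF g] by simp
  have git: "Suc k * t \<le> g (i t)" if t: "t \<in> {1..<d}" for t
  proof -
    have "t + k * t \<le> k * (i t - t) + k * t" using R t by simp
    also have "\<dots> = k * i t"
      using less_i[of t] t by (simp add: add_mult_distrib2[symmetric])
    finally have "Suc k * t \<le> k * i t" by simp
    \<comment> \<open>For \<open>t < d\<close> the cap in \<open>g\<close> lies above the bound
      required, so it does no harm.\<close>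
    moreover have "Suc k * t + 1 \<le> Suc k * d"
    proof -
      have "Suc k * Suc t \<le> Suc k * d" using t by (intro mult_le_mono2) simp
      then show ?thesis by simp
    qed
    ultimately show ?thesis by (simp add: g_def)
  qed
  \<comment> \<open>There must be enough variables to reach the cap. For \<open>d > 1\<close> this
    follows from the condition at \<open>t = d - 1\<close> together with
    \<open>i t < n\<close>.\<close>
  have gn: "g n = Suc k * d - 1"
  proof (cases "d = 1")
    case True
    have "1 \<le> n" using less_i[of d] i_d d_pos by auto
    then show ?thesis using True by (simp add: g_def min_absorb2)
  next
    case False
    define t where "t = d - 1"
    have t: "t \<in> {1..<d}" "d = Suc t" using False d_pos by (auto simp: t_def)
    have "t + k * d \<le> k * (i t - t) + k * d" using R t by simp
    also have "\<dots> = k * (i t - t + d)" by (simp add: add_mult_distrib2)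
    also have "\<dots> \<le> k * n" using i_less_n[OF t(1)] less_i[of t] t by (intro mult_le_mono2) auto
    finally have "Suc k * d - 1 \<le> k * n" using t(2) by simp
    then show ?thesis by (simp add: g_def)
  qed
  show ?L
  proof (intro bexI[of _ e] conjI ballI)
    show e: "e \<in> monomials n" by (simp add: e_def mono_of_in_monomials)
    have "(\<Sum>s=1..i d. min (Poly_Mapping.lookup e s) (Suc k)) = g n"
      using le sums[of n] i_d by (simp add: min_absorb1 le_SucI)
    moreover have "g n < Suc k * d" using gn d_pos by simp
    ultimately have "\<not> Suc k * d \<le> (\<Sum>s=1..i d. min (Poly_Mapping.lookup e s) (Suc k))" by linarith
    then show "e \<notin> power_monomials (Suc k)" using d_pos by (auto simp: power_monomials_def)
    fix r assume r: "r \<in> {1..n}"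
    show "e + Poly_Mapping.single r 1 \<in> power_monomials (Suc k)"
      unfolding power_monomials_def
    proof (intro CollectI conjI ballI)
      show "e + Poly_Mapping.single r 1 \<in> monomials n"
        using r by (intro monomials_add[OF e]) (auto simp: monomials_def)
      fix t assume t: "t \<in> {1..d}"
      have "min (Poly_Mapping.lookup (e + Poly_Mapping.single r 1) s) (Suc k)
          = Poly_Mapping.lookup e s + (if s = r then 1 else 0)" for s
        using le[of s] by (auto simp: lookup_add lookup_single when_def)
      then have eq: "(\<Sum>s=1..i t. min (Poly_Mapping.lookup (e + Poly_Mapping.single r 1) s) (Suc k))
          = g (i t) + (if r \<le> i t then 1 else 0)"
        using sums[OF i_le_n[OF t]] r by (simp add: sum.distrib)
      show "Suc k * t \<le> (\<Sum>s=1..i t. min (Poly_Mapping.lookup (e + Poly_Mapping.single r 1) s) (Suc k))"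
      proof (cases "t = d")
        case True
        then show ?thesis unfolding eq using gn r i_d by simp
      next
        case False
        then show ?thesis unfolding eq using git[of t] t by simp
      qed
    qed
  qed
qed

section \<open>The Borel generator and the principal ideal it determines\<close>

abbreviation generator :: monomial where
  "generator \<equiv> \<Sum>r=1..d. Poly_Mapping.single (i r) 1"

lemma i_inj: "inj_on i {1..d}"
  using smono by (rule strict_mono_on_imp_inj_on)

lemma lookup_generator: "Poly_Mapping.lookup generator s = (if s \<in> i ` {1..d} then 1 else 0)"
proof -
  have "Poly_Mapping.lookup generator s = (\<Sum>r\<in>{1..d}. if i r = s then 1 else 0)"
    by (auto simp: lookup_sum lookup_single when_def intro!: sum.cong)
  also have "\<dots> = (\<Sum>x\<in>i ` {1..d}. if x = s then 1 else 0)"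
    by (subst sum.reindex[OF i_inj]) simp
  also have "\<dots> = (if s \<in> i ` {1..d} then 1 else 0)" by (subst sum.delta) auto
  finally show ?thesis .
qed

lemma prefix_generator: "(\<Sum>s=1..j. Poly_Mapping.lookup generator s) = card (i ` {1..d} \<inter> {1..j})"
  unfolding lookup_generator by (simp add: sum.If_cases Int_commute)

lemma generators_upto: 
  assumes "t \<in> {1..d}" 
  shows "i ` {1..d} \<inter> {1..i t} = i ` {1..t}"
proof -
  have "i r \<le> i t \<longleftrightarrow> r \<le> t" if "r \<in> {1..d}" for r
    using i_less[OF that assms] i_less[OF assms that] by (cases r t rule: linorder_cases) auto
  moreover have "1 \<le> i r" if "r \<in> {1..d}" for r using less_i[OF that] by simp
  ultimately show ?thesis using assms by fastforce
qed

lemma card_generators_upto: "t \<in> {1..d} \<Longrightarrow> card (i ` {1..d} \<inter> {1..i t}) = t"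
  using i_inj by (subst generators_upto) (auto simp: card_image inj_on_subset)

lemma generator_in_borel_gens: "generator \<in> borel_gens"
  unfolding borel_gens_def
proof (intro CollectI conjI ballI)
  show m: "generator \<in> monomials n"
  proof -
    have "Poly_Mapping.keys generator \<subseteq> i ` {1..d}"
      unfolding subset_iff in_keys_iff lookup_generator by simp
    moreover have "i t \<in> {1..n}" if "t \<in> {1..d}" for t
      using less_i[OF that] i_le_n[OF that] by simp
    ultimately show ?thesis by (auto simp: monomials_def)
  qed
  show "squarefree_mono generator" unfolding squarefree_mono_def lookup_generator by simp
  show "mono_degree generator = d"
    using mono_degree_eq[OF m] prefix_generator[of n] card_generators_upto[of d] i_d d_pos by simp
  show "t \<le> (\<Sum>s=1..i t. Poly_Mapping.lookup generator s)" if "t \<in> {1..d}" for t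
    using that prefix_generator card_generators_upto by simp
qed

text \<open>The prefix sums of the generator jump only at the indices \<open>i t\<close>, so it
  suffices to compare at the largest such index not exceeding \<open>j\<close>.\<close>

lemma prefix_generator_le:
  assumes "w \<in> borel_gens"
  shows "(\<Sum>s=1..j. Poly_Mapping.lookup generator s) \<le> (\<Sum>s=1..j. Poly_Mapping.lookup w s)"
proof (cases "i ` {1..d} \<inter> {1..j} = {}")
  case False
  define x where "x = Max (i ` {1..d} \<inter> {1..j})"
  have x: "x \<in> i ` {1..d} \<inter> {1..j}" unfolding x_def using False by (intro Max_in) auto
  then obtain t where t: "t \<in> {1..d}" "x = i t" by blast
  have "y \<le> x" if "y \<in> i ` {1..d} \<inter> {1..j}" for y
    unfolding x_def using that by (intro Max_ge) auto
  then have "i ` {1..d} \<inter> {1..j} = i ` {1..d} \<inter> {1..i t}" using x t by auto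
  then have "(\<Sum>s=1..j. Poly_Mapping.lookup generator s) = t"
    using prefix_generator card_generators_upto t by simp
  also have "t \<le> (\<Sum>s=1..i t. Poly_Mapping.lookup w s)" using assms t by (simp add: borel_gens_def)
  also have "\<dots> \<le> (\<Sum>s=1..j. Poly_Mapping.lookup w s)" using x t by (intro sum_mono2) auto
  finally show ?thesis .
qed (unfold prefix_generator, simp)

text \<open>Moving a variable to a smaller index can only increase prefix sums.\<close>

lemma borel_gens_exchange:
  assumes w: "w \<in> borel_gens"
    and pq: "1 \<le> p" "p < q" "q \<le> n" "q \<in> Poly_Mapping.keys w" "p \<notin> Poly_Mapping.keys w"
  shows "Poly_Mapping.single p 1 + (w - Poly_Mapping.single q 1) \<in> borel_gens" (is "?v \<in> _")
proof -
  have le1: "Poly_Mapping.lookup w s \<le> 1" for s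
    using w by (simp add: borel_gens_def squarefree_mono_def)
  have wq: "Poly_Mapping.lookup w q = 1" using le1[of q] pq by (simp add: in_keys_iff)
  have wp: "Poly_Mapping.lookup w p = 0" using pq by (simp add: in_keys_iff)
  have lv: "Poly_Mapping.lookup ?v s = (if s = p then 1 else if s = q then 0 else Poly_Mapping.lookup w s)" for s
    using wp wq pq by (auto simp: lookup_add lookup_minus lookup_single when_def)
  have "Poly_Mapping.lookup ?v s + (if q = s then 1 else 0)
      = Poly_Mapping.lookup w s + (if p = s then 1 else 0)" for s
    unfolding lv using wp wq pq by auto
  then have "(\<Sum>s=1..j. Poly_Mapping.lookup ?v s + (if q = s then 1 else 0))
      = (\<Sum>s=1..j. Poly_Mapping.lookup w s + (if p = s then 1 else 0))" for j by simp
  then have sums: "(\<Sum>s=1..j. Poly_Mapping.lookup ?v s) + (if q \<le> j then 1 else 0)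
      = (\<Sum>s=1..j. Poly_Mapping.lookup w s) + (if p \<le> j then 1 else 0)" for j
    using pq by (simp add: sum.distrib)
  show ?thesis
    unfolding borel_gens_def
  proof (intro CollectI conjI ballI)
    have wm: "w \<in> monomials n" using w by (simp add: borel_gens_def)
    show m: "?v \<in> monomials n"
    proof -
      have "Poly_Mapping.keys ?v \<subseteq> insert p (Poly_Mapping.keys w)"
      proof
        fix s assume "s \<in> Poly_Mapping.keys ?v"
        then show "s \<in> insert p (Poly_Mapping.keys w)"
          unfolding insert_iff in_keys_iff lv by (auto split: if_splits)
      qed
      then show ?thesis using wm pq unfolding monomials_def by auto
    qed
    show "squarefree_mono ?v" unfolding squarefree_mono_def lv using le1 by auto
    show "mono_degree ?v = d"
      using mono_degree_eq[OF m] mono_degree_eq[OF wm] w sums[of n] pq by (simp add: borel_gens_def)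
    fix t assume "t \<in> {1..d}"
    then have "t \<le> (\<Sum>s=1..i t. Poly_Mapping.lookup w s)" using w by (simp add: borel_gens_def)
    also have "\<dots> \<le> (\<Sum>s=1..i t. Poly_Mapping.lookup ?v s)"
      using sums[of "i t"] pq(2) by (auto split: if_splits)
    finally show "t \<le> (\<Sum>s=1..i t. Poly_Mapping.lookup ?v s)" .
  qed
qed

lemma borel_gens_props:
  "borel_gens \<subseteq> monomials n" "\<And>w. w \<in> borel_gens \<Longrightarrow> mono_degree w = d"
  "\<And>w. w \<in> borel_gens \<Longrightarrow> squarefree_mono w"
  by (auto simp: borel_gens_def)

lemma squarefree_strongly_stable_borel:
  "squarefree_strongly_stable n (mono_span (power_monomials 1) :: 'k::field mpoly set)"
proof -
  have "min_gens n (mono_span (power_monomials 1) :: 'k mpoly set) = borel_gens"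
    unfolding min_gens_mono_span[OF absorbing_power_monomials]
    unfolding multiples_borel_gens[symmetric]
    by (rule primitive_multiples[OF borel_gens_props(1,2)])
  moreover have "monomial_ideal n (mono_span (power_monomials 1) :: 'k mpoly set)"
    unfolding monomial_ideal_def
    by (intro exI[of _ borel_gens] conjI borel_gens_props(1))
      (simp only: Idl_mon[OF borel_gens_props(1)] multiples_borel_gens)
  ultimately show ?thesis
    using borel_gens_props(2,3) borel_gens_exchange
    unfolding squarefree_strongly_stable_def by simp
qed

text \<open>One inclusion is the minimality of \<open>I\<close> against the explicit ideal, which is
  squarefree strongly stable. For the other, every element of \<open>borel_gens\<close> dominates
  the generator, so \<open>borel_closure\<close> places it in \<open>G(I)\<close>.\<close>

lemma principal_eq:
  fixes I :: "'k::field mpoly set"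
  assumes "squarefree_strongly_stable_principal n generator I"
  shows "I = mono_span (power_monomials 1)"
proof
  have sss: "squarefree_strongly_stable n I" and gen: "generator \<in> min_gens n I"
    and least: "\<And>J. squarefree_strongly_stable n J \<Longrightarrow> mon generator \<in> J \<Longrightarrow> I \<subseteq> J"
    using assms by (auto simp: squarefree_strongly_stable_principal_def)
  have "generator \<in> power_monomials 1"
    using generator_in_borel_gens multiples_borel_gens subset_multiples by blast
  then show "I \<subseteq> mono_span (power_monomials 1)"
    by (intro least squarefree_strongly_stable_borel) simp
  obtain A where A: "A \<subseteq> monomials n" "I = Idl\<^bsub>poly_ring n\<^esub> (mon ` A)"
    using sss by (auto simp: squarefree_strongly_stable_def monomial_ideal_def)
  define F where "F = multiples n A"
  have F: "absorbing n F" "I = mono_span F"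
    using A Idl_mon absorbing_multiples by (auto simp: F_def)
  have G: "min_gens n I = primitive n F" unfolding F(2) by (rule min_gens_mono_span[OF F(1)])
  have "borel_gens \<subseteq> min_gens n I"
  proof
    fix w assume w: "w \<in> borel_gens"
    obtain d' where d': "\<And>u. u \<in> min_gens n I \<Longrightarrow> mono_degree u = d'"
      using sss by (auto simp: squarefree_strongly_stable_def)
    have "d' = d" using d'[OF gen] borel_gens_props(2)[OF generator_in_borel_gens] by simp
    show "w \<in> min_gens n I"
    proof (rule borel_closure[where v = generator and d = d and n = n])
      show "v \<in> monomials n \<and> squarefree_mono v \<and> mono_degree v = d" if "v \<in> min_gens n I" for v
        using that sss d' \<open>d' = d\<close> F(1) 
        by (auto simp: squarefree_strongly_stable_def G primitive_def absorbing_def)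
      show "Poly_Mapping.single p 1 + (v - Poly_Mapping.single q 1) \<in> min_gens n I"
        if "v \<in> min_gens n I" "1 \<le> p" "p < q" "q \<le> n" "q \<in> Poly_Mapping.keys v" "p \<notin> Poly_Mapping.keys v"
        for v p q
        using sss that unfolding squarefree_strongly_stable_def by blast
    qed (use w gen borel_gens_props prefix_generator_le in auto)
  qed
  then have "borel_gens \<subseteq> F" using G by (auto simp: primitive_def)
  then have "multiples n borel_gens \<subseteq> F" using F(1) by (auto simp: multiples_def absorbing_def)
  then show "mono_span (power_monomials 1) \<subseteq> I"
    unfolding F(2) multiples_borel_gens by (auto simp: mono_span_def)
qed

lemma max_ideal_in_Ass_power_iff:
  fixes I :: "'k::field mpoly set"
  assumes "squarefree_strongly_stable_principal n generator I"
  shows "max_ideal n \<in> Ass (poly_ring n) (I [^]\<^bsub>ideals_set (poly_ring n)\<^esub> Suc k)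
    \<longleftrightarrow> (\<forall>t\<in>{1..<d}. t \<le> k * (i t - t))"
  unfolding principal_eq[OF assms] ideal_power max_ideal_in_Ass_iff[OF absorbing_power_monomials]
  by (rule socle_iff)

end

section \<open>Interval decomposition of the exponents\<close>

locale interval_decomposition =
  fixes S :: "nat set" and m :: nat and a b :: "nat \<Rightarrow> nat"
  assumes S_eq: "S = (\<Union>j\<in>{1..m}. {a j..b j})"
    and a_le_b: "j \<in> {1..m} \<Longrightarrow> a j \<le> b j"
    and gap: "1 \<le> j \<Longrightarrow> j < m \<Longrightarrow> b j + 1 < a (j + 1)"
    and a_1: "1 < a 1"
begin

text \<open>When \<open>S\<close> consists of the indices \<open>i t\<close>, this inverts
  \<open>i\<close>: \<open>count (i t) = t\<close>.\<close>

definition count :: "nat \<Rightarrow> nat" where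
  "count x = card (S \<inter> {1..x})"

lemma b_less_a: "1 \<le> j \<Longrightarrow> j < j' \<Longrightarrow> j' \<le> m \<Longrightarrow> b j + 1 < a j'"
proof (induction j')
  case (Suc j')
  show ?case
  proof (cases "j = j'")
    case False
    then have "b j + 1 < a j'" "a j' \<le> b j'" using Suc a_le_b[of j'] by auto
    then show ?thesis using gap[of j'] Suc.prems by simp
  qed (use gap[of j] Suc.prems in simp)
qed simp

lemma a_gt_1: "j \<in> {1..m} \<Longrightarrow> 1 < a j"
  using a_1 b_less_a[of 1 j] a_le_b[of 1] by (cases "j = 1") auto

lemma count_mono: "x \<le> y \<Longrightarrow> count x \<le> count y"
  unfolding count_def by (intro card_mono) auto

text \<open>All integers from \<open>a j\<close> to \<open>x\<close> belong to \<open>S\<close>.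
  Consequently \<open>x - count x\<close> is constant on the interval.\<close>

lemma count_in_interval:
  assumes j: "j \<in> {1..m}" and x: "x \<in> {a j..b j}"
  shows "count x = count (a j - 1) + (x - a j + 1)"
proof -
  have "{a j..x} \<subseteq> S" using assms unfolding S_eq by auto
  then have "S \<inter> {1..x} = (S \<inter> {1..a j - 1}) \<union> {a j..x}"
    using a_gt_1[OF j] x by auto
  also have "card \<dots> = count (a j - 1) + card {a j..x}"
    unfolding count_def by (rule card_Un_disjoint) auto
  also have "card {a j..x} = x - a j + 1" using x by (simp add: Suc_diff_le)
  finally show ?thesis by (simp add: count_def)
qed

lemma count_before_first: "1 \<le> m \<Longrightarrow> count (a 1 - 1) = 0"
proof -
  assume "1 \<le> m"
  have "a 1 \<le> x" if "x \<in> S" for x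
  proof -
    obtain j where j: "j \<in> {1..m}" "a j \<le> x" using \<open>x \<in> S\<close> unfolding S_eq by auto
    then show ?thesis using b_less_a[of 1 j] a_le_b[of 1] by (cases "j = 1") auto
  qed
  then have "S \<inter> {1..a 1 - 1} = {}" using a_1 by fastforce
  then show ?thesis by (simp add: count_def)
qed

lemma count_before_next:
  assumes "1 \<le> j" "j < m"
  shows "count (a (j + 1) - 1) = count (b j)"
proof -
  have "x \<le> b j" if "x \<in> S" "x < a (j + 1)" for x
  proof -
    obtain r where r: "r \<in> {1..m}" "a r \<le> x" "x \<le> b r" using \<open>x \<in> S\<close> unfolding S_eq by auto
    have "r \<le> j"
    proof (rule ccontr)
      assume "\<not> r \<le> j"
      then have "a (j + 1) \<le> a r"
        using b_less_a[of "j + 1" r] a_le_b[of "j + 1"] r assms by (cases "r = j + 1") auto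
      then show False using r that by simp
    qed
    then have "b r \<le> b j"
      using b_less_a[of r j] a_le_b[of j] r assms by (cases "r = j") auto
    then show ?thesis using r by simp
  qed
  then have "S \<inter> {1..a (j + 1) - 1} = S \<inter> {1..b j}"
    using gap[OF assms] by fastforce
  then show ?thesis by (simp add: count_def)
qed

text \<open>The sum is the number of positive integers below \<open>a j\<close> outside
  \<open>S\<close>, which is the constant value of \<open>x - count x\<close> on the
  \<open>j\<close>-th interval. Positivity makes it a legitimate denominator.\<close>

lemma sum_gaps:
  fixes k :: "nat \<Rightarrow> int"
  assumes k: "\<And>j. j \<in> {1..m} \<Longrightarrow> k j = (if j = 1 then int (a 1) - 1 else int (a j) - int (b (j - 1)) - 1)"
    and "j \<in> {1..m}"
  shows "(\<Sum>t=1..j. k t) = int (a j) - 1 - int (count (a j - 1))" "(\<Sum>t=1..j. k t) > 0"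
proof -
  have "1 \<le> j \<Longrightarrow> j \<le> m \<Longrightarrow> (\<Sum>t=1..j. k t) = int (a j) - 1 - int (count (a j - 1))"
  proof (induction j rule: nat_induct_at_least)
    case base
    then show ?case using k[of 1] count_before_first by simp
  next
    case (Suc j)
    have bj: "int (count (b j)) = int (count (a j - 1)) + int (b j) - int (a j) + 1"
      using count_in_interval[of j "b j"] a_le_b[of j] Suc by simp
    have "(\<Sum>t=1..Suc j. k t) = (\<Sum>t=1..j. k t) + k (Suc j)" by simp
    then show ?case using Suc k[of "Suc j"] bj count_before_next[of j] by simp
  qed
  then show "(\<Sum>t=1..j. k t) = int (a j) - 1 - int (count (a j - 1))" using assms(2) by simp
  have "k t > 0" if "t \<in> {1..j}" for t
  proof (cases "t = 1")
    case True
    then show ?thesis using k[of t] that assms(2) a_1 by simp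
  next
    case False
    then obtain r where "t = r + 1" "1 \<le> r" using \<open>t \<in> {1..j}\<close> by (cases t) auto
    then have "b (t - 1) + 1 < a t" using gap[of r] that assms(2) by simp
    then show ?thesis using k[of t] that assms(2) False by simp
  qed
  then show "(\<Sum>t=1..j. k t) > 0" using assms(2) by (intro sum_pos) auto
qed

text \<open>The lengths add up to the rank of \<open>b j\<close> in \<open>S\<close>; the last
  interval is short by one because \<open>l m\<close> lacks the final \<open>+ 1\<close>.\<close>

lemma sum_lengths:
  fixes l :: "nat \<Rightarrow> int"
  assumes l: "\<And>j. j \<in> {1..m} \<Longrightarrow> l j = (if j < m then int (b j) - int (a j) + 1 else int (b m) - int (a m))"
    and "j \<in> {1..m}"
  shows "(\<Sum>t=1..j. l t) = int (count (b j)) - (if j = m then 1 else 0)"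
proof -
  have step: "int (count (b j)) = int (count (a j - 1)) + int (b j) - int (a j) + 1" if "j \<in> {1..m}" for j
    using count_in_interval[OF that, of "b j"] a_le_b[OF that] by simp
  have "1 \<le> j \<Longrightarrow> j \<le> m \<Longrightarrow> (\<Sum>t=1..j. l t) = int (count (b j)) - (if j = m then 1 else 0)"
  proof (induction j rule: nat_induct_at_least)
    case base
    then show ?case using l[of 1] count_before_first step[of 1] by auto
  next
    case (Suc j)
    have "(\<Sum>t=1..Suc j. l t) = (\<Sum>t=1..j. l t) + l (Suc j)" by simp
    then show ?case using Suc l[of "Suc j"] step[of "Suc j"] count_before_next[of j] by auto
  qed
  then show ?thesis using assms(2) by simp
qed

end

section \<open>From the membership criterion to the formula for the index\<close>

lemma index_of_stability_eqI:
  assumes "c \<ge> 1" "\<And>k. P \<in> Ass R (I [^]\<^bsub>ideals_set R\<^esub> Suc k) \<longleftrightarrow> c \<le> Suc k"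
  shows "index_of_stability R P I = enat c"
proof -
  have iff: "k \<ge> 1 \<and> P \<in> Ass R (I [^]\<^bsub>ideals_set R\<^esub> k) \<longleftrightarrow> c \<le> k" for k :: nat
    using assms by (cases k) auto
  have "(LEAST k. c \<le> k) = c" by (rule Least_equality) auto
  then show ?thesis unfolding index_of_stability_def iff by auto
qed

theorem theorem2p2:
  fixes I :: "'k::field mpoly set"
    and n d m :: nat
    and i a b :: "nat \<Rightarrow> nat"
    and l k :: "nat \<Rightarrow> int"
  assumes "n > 1" and "d \<ge> 1"
    and "strict_mono_on {1..d} i" and "1 < i 1" and "i d = n"
    and "squarefree_strongly_stable_principal n (\<Sum>r=1..d. Poly_Mapping.single (i r) 1) I"
    and "i ` {1..d} = (\<Union>j\<in>{1..m}. {a j..b j})"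
    and "\<And>j. j \<in> {1..m} \<Longrightarrow> a j \<le> b j"
    and "\<And>j. 1 \<le> j \<Longrightarrow> j < m \<Longrightarrow> b j + 1 < a (j + 1)"
    and "\<And>j. j \<in> {1..m} \<Longrightarrow> l j = (if j < m then int (b j) - int (a j) + 1 else int n - int (a m))"
    and "\<And>j. j \<in> {1..m} \<Longrightarrow> k j = (if j = 1 then int (a 1) - 1 else int (a j) - int (b (j - 1)) - 1)"
  shows "index_of_stability (poly_ring n) (max_ideal n) I =
    enat (nat (Max ((\<lambda>j. \<lceil>real_of_int (\<Sum>t=1..j. l t) / real_of_int (\<Sum>t=1..j. k t)\<rceil> + 1) ` {1..m})))"
proof -
  interpret borel_exponents n d i
    by unfold_locales (use assms in auto)
  let ?S = "i ` {1..d}"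
  have S_mem: "i t \<in> ?S" if "t \<in> {1..d}" for t using that by blast
  have m: "1 \<in> {1..m}"
  proof -
    have "i d \<in> ?S" using S_mem[of d] d_pos by simp
    then obtain j where "j \<in> {1..m}" unfolding assms(7) by blast
    then show ?thesis by simp
  qed
  have S_gt_1: "1 < x" if "x \<in> ?S" for x using less_i that by fastforce
  interpret interval_decomposition ?S m a b
  proof
    have "a 1 \<in> ?S" unfolding assms(7) using assms(8) m by force
    then show "1 < a 1" by (rule S_gt_1)
  qed (use assms in auto)
  have ab_S: "a j \<in> ?S" "b j \<in> ?S" if "j \<in> {1..m}" for j
    unfolding assms(7) using assms(8)[OF that] that by force+
  have mm: "m \<in> {1..m}" using m by simp
  have bm: "b m = n"
  proof (rule antisym)
    show "b m \<le> n" using ab_S[OF mm] i_le_n by auto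
    have "n \<in> ?S" using S_mem[of d] d_pos i_d by simp
    then obtain j where "j \<in> {1..m}" "n \<le> b j" unfolding assms(7) by auto
    then show "n \<le> b m" using b_less_a[of j m] a_le_b[OF mm] by (cases "j = m") auto
  qed
  have count_i: "count (i t) = t" if "t \<in> {1..d}" for t
    unfolding count_def by (rule card_generators_upto[OF that])
  have count_n: "count n = d" using count_i[of d] i_d d_pos by simp
  define K where "K j = (\<Sum>t=1..j. k t)" for j
  define L where "L j = (\<Sum>t=1..j. l t)" for j
  have K: "K j = int (a j) - 1 - int (count (a j - 1))" "K j > 0" if "j \<in> {1..m}" for j
    unfolding K_def using sum_gaps[OF assms(11) that] by auto
  have L: "L j = int (count (b j)) - (if j = m then 1 else 0)" if "j \<in> {1..m}" for j
    unfolding L_def using assms(10) bm by (intro sum_lengths that) auto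
  have gap_count: "int (i t - t) = K j" if t: "t \<in> {1..d}" and j: "j \<in> {1..m}" "i t \<in> {a j..b j}" for t j
  proof -
    have "int t = int (count (a j - 1)) + int (i t) - int (a j) + 1"
      using count_in_interval[OF j] count_i[OF t] j(2)[unfolded atLeastAtMost_iff] by linarith
    then show ?thesis using K(1)[OF j(1)] less_i[OF t] by simp
  qed
  \<comment> \<open>On one interval the factor \<open>i t - t\<close> has the constant value
    \<open>K j\<close>, so the largest admissible \<open>t\<close> gives the strongest condition;
    \<open>L j\<close> is that \<open>t\<close>.\<close>
  have condition_iff: "(\<forall>t\<in>{1..<d}. t \<le> q * (i t - t)) \<longleftrightarrow> (\<forall>j\<in>{1..m}. L j \<le> int q * K j)" for q
  proof (intro iffI ballI)
    fix j assume R: "\<forall>t\<in>{1..<d}. t \<le> q * (i t - t)" and j: "j \<in> {1..m}"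
    have R': "int t \<le> int q * int (i t - t)" if "t \<in> {1..<d}" for t
      using R that by (metis of_nat_le_iff of_nat_mult)
    show "L j \<le> int q * K j"
    proof (cases "j = m")
      case False
      obtain t where t: "t \<in> {1..d}" "b j = i t" using ab_S(2)[OF j] by blast
      \<comment> \<open>The right end of an interval before the last is not \<open>n\<close>, so its
        position \<open>t\<close> is below \<open>d\<close> and the hypothesis applies.\<close>
      have "b j < n" using False j b_less_a[of j m] a_le_b[OF mm] bm by simp
      then have "t \<in> {1..<d}" using t i_d by (cases "t = d") auto
      then have "int t \<le> int q * int (i t - t)" by (rule R')
      moreover have "int (i t - t) = K j" using gap_count[OF t(1) j] t(2) a_le_b[OF j] by simp
      moreover have "L j = int t" using L[OF j] False t count_i by simp
      ultimately show ?thesis by simp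
    next
      case True
      have Lm: "L j = int d - 1" using L[OF j] True bm count_n by simp
      show ?thesis
      proof (cases "d = 1")
        case True
        then show ?thesis using Lm K(2)[OF j] by simp
      next
        case False
        \<comment> \<open>\<open>L m = d - 1\<close> calls for the condition at
          \<open>t = d - 1\<close>. If \<open>a m = n\<close>, the index \<open>i t\<close> lies in
          an earlier interval, so only \<open>i t - t \<le> n - d\<close> is used instead of an
          equality.\<close>
        define t where "t = d - 1"
        have t: "t \<in> {1..<d}" "d = Suc t" using False d_pos by (auto simp: t_def)
        have "int t \<le> int q * int (i t - t)" by (rule R'[OF t(1)])
        also have "\<dots> \<le> int q * int (n - d)"
          using i_less_n[OF t(1)] t(2) by (intro mult_left_mono) auto
        also have "int (n - d) = K j"
          using gap_count[of d j] d_pos i_d bm j True a_le_b[OF mm] by simp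
        finally show ?thesis using Lm t(2) by simp
      qed
    qed
  next
    fix t assume R: "\<forall>j\<in>{1..m}. L j \<le> int q * K j" and t: "t \<in> {1..<d}"
    then have t': "t \<in> {1..d}" by simp
    obtain j where j: "j \<in> {1..m}" "i t \<in> {a j..b j}" using S_mem[OF t'] unfolding assms(7) by blast
    have "t \<le> count (b j)" using count_mono[of "i t" "b j"] count_i[OF t'] j(2) by simp
    \<comment> \<open>On the last interval the subtracted 1 is absorbed by
      \<open>t < d\<close>.\<close>
    then have "int t \<le> L j" using L[OF j(1)] bm count_n t by auto
    also have "\<dots> \<le> int q * int (i t - t)" using R j(1) gap_count[OF t' j] by simp
    finally show "t \<le> q * (i t - t)" by (metis of_nat_le_iff of_nat_mult)
  qed
  define X where "X j = \<lceil>real_of_int (L j) / real_of_int (K j)\<rceil> + 1" for j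
  have X_iff: "X j \<le> int q + 1 \<longleftrightarrow> L j \<le> int q * K j" if "j \<in> {1..m}" for j q
  proof -
    have "X j \<le> int q + 1 \<longleftrightarrow> real_of_int (L j) / real_of_int (K j) \<le> real q"
      by (simp add: X_def ceiling_le_iff)
    also have "\<dots> \<longleftrightarrow> real_of_int (L j) \<le> real_of_int (int q * K j)"
      using K(2)[OF that] by (simp add: divide_le_eq)
    finally show ?thesis by (simp only: of_int_le_iff)
  qed
  have "index_of_stability (poly_ring n) (max_ideal n) I = enat (nat (Max (X ` {1..m})))"
  proof (rule index_of_stability_eqI)
    \<comment> \<open>This makes the maximum at least 1, so the candidate index is a positive
      exponent.\<close>
    have "L 1 \<ge> 0" using L[OF m] count_n bm d_pos by (cases "1 = m") auto
    then have "real_of_int (L 1) / real_of_int (K 1) \<ge> 0" using K(2)[OF m] by simp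
    then have "X 1 \<ge> 1" unfolding X_def by linarith
    moreover have "X 1 \<le> Max (X ` {1..m})" using m by (intro Max_ge) auto
    ultimately show "1 \<le> nat (Max (X ` {1..m}))" by linarith
    fix q
    have "max_ideal n \<in> Ass (poly_ring n) (I [^]\<^bsub>ideals_set (poly_ring n)\<^esub> Suc q)
        \<longleftrightarrow> (\<forall>j\<in>{1..m}. X j \<le> int q + 1)"
      unfolding max_ideal_in_Ass_power_iff[OF assms(6)] condition_iff using X_iff by blast
    also have "\<dots> \<longleftrightarrow> Max (X ` {1..m}) \<le> int q + 1"
      using m by (subst Max_le_iff) auto
    finally show "max_ideal n \<in> Ass (poly_ring n) (I [^]\<^bsub>ideals_set (poly_ring n)\<^esub> Suc q)
        \<longleftrightarrow> nat (Max (X ` {1..m})) \<le> Suc q" by linarith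
  qed
  then show ?thesis by (simp only: X_def[abs_def] L_def K_def)
qed

end
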